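(* There are positive numbers $d$ and $C$ and a sequence $(X_n)$ of pairwise distinct triangulations of the sphere $\mathbb{S}^2$, with degree at most $d$ and $\operatorname{diam} X_n\ge 2$, such that $$\tau(X_n)\le C\,\frac{(\operatorname{diam} X_n)^2}{\log(\operatorname{diam} X_n)}$$ for all $n$.
   Context: A triangulation is identified with the graph which is its $1$-skeleton; triangulations are considered up to isomorphism, so "pairwise distinct" means pairwise non-isomorphic. The degree of a graph is the maximum over its vertices of the number of adjacent edges. $\operatorname{diam} X$ is the diameter of $X$ for the path metric in which every edge has length $1$. $\tau(X)$ is the mixing time of the simple random walk on $X$: if $P$ is the transition matrix of the simple random walk (from a vertex, move along a uniformly chosen adjacent edge) and $\pi$ its stationary distribution, then $\tau(X)=\min\{t\in\mathbb{N} : \max_{x}\|P^t(x,\cdot)-\pi\|_{TV}\le \tfrac14\}$, with $\|\cdot\|_{TV}$ the total variation distance, and $\tau(X)=\infty$ if no such $t$ exists. *)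

theory Defs
  imports
    "HOL-Probability.Probability"
    "Graph_Theory.Graph_Theory"
begin

definition abstract_simplicial_complex :: "'a set set \<Rightarrow> bool" where
  "abstract_simplicial_complex K \<longleftrightarrow>
     (\<forall>\<sigma>\<in>K. finite \<sigma> \<and> \<sigma> \<noteq> {}) \<and>
     (\<forall>\<sigma>\<in>K. \<forall>\<tau>. \<tau> \<subseteq> \<sigma> \<and> \<tau> \<noteq> {} \<longrightarrow> \<tau> \<in> K)"

(* Points are given by barycentric coordinates. The subspace topology inherited from the
   product topology on 'a => real is the usual topology of the realization when K is finite,
   the only case used below. *)
definition geometric_realization :: "'a set set \<Rightarrow> ('a \<Rightarrow> real) set" where
  "geometric_realization K =
     {x. (\<forall>v. 0 \<le> x v) \<and> {v. x v \<noteq> 0} \<in> K \<and> (\<Sum>v | x v \<noteq> 0. x v) = 1}"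

(* Finiteness is automatic for a triangulation of a compact space. *)
definition sphere_triangulation :: "'a set set \<Rightarrow> bool" where
  "sphere_triangulation K \<longleftrightarrow>
     finite K \<and> abstract_simplicial_complex K \<and>
     geometric_realization K homeomorphic (sphere 0 1 :: (real ^ 3) set)"

(* An undirected edge {u, v} is represented by the two arcs (u, v) and (v, u), as in the locale
   graph of Graph_Theory; the edges adjacent to v correspond to the arcs leaving v. *)
definition one_skeleton :: "'a set set \<Rightarrow> ('a, 'a \<times> 'a) pre_digraph" where
  "one_skeleton K =
     \<lparr>verts = \<Union>K, arcs = {(u, v). u \<noteq> v \<and> {u, v} \<in> K}, tail = fst, head = snd\<rparr>"

definition graph_degree :: "('a, 'b) pre_digraph \<Rightarrow> nat" where
  "graph_degree G = (MAX v\<in>verts G. out_degree G v)"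

(* The coercion real_of_ereal sends the diameter (infinity) of a disconnected graph to 0. *)
definition graph_diam :: "('a, 'b) pre_digraph \<Rightarrow> real" where
  "graph_diam G =
     real_of_ereal (SUP u\<in>verts G. SUP v\<in>verts G. wf_digraph.\<mu> G (\<lambda>_. 1) u v)"

(* The row P(v, _) of the transition matrix, for a vertex v that has at least one edge. *)
definition srw_step :: "('a, 'b) pre_digraph \<Rightarrow> 'a \<Rightarrow> 'a pmf" where
  "srw_step G v = map_pmf (head G) (pmf_of_set (out_arcs G v))"

(* P^t(x, _). *)
definition srw :: "('a, 'b) pre_digraph \<Rightarrow> nat \<Rightarrow> 'a \<Rightarrow> 'a pmf" where
  "srw G t x = ((\<lambda>p. bind_pmf p (srw_step G)) ^^ t) (return_pmf x)"

(* Unique for a finite connected graph with at least one edge. *)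
definition srw_stationary :: "('a, 'b) pre_digraph \<Rightarrow> 'a pmf" where
  "srw_stationary G = (THE p. set_pmf p \<subseteq> verts G \<and> bind_pmf p (srw_step G) = p)"

definition total_variation :: "'a pmf \<Rightarrow> 'a pmf \<Rightarrow> real" where
  "total_variation p q = (SUP A. \<bar>measure_pmf.prob p A - measure_pmf.prob q A\<bar>)"

(* The infimum of the empty set is infinity. *)
definition mixing_time :: "('a, 'b) pre_digraph \<Rightarrow> enat" where
  "mixing_time G =
     Inf {enat t | t. (MAX x\<in>verts G. total_variation (srw G t x) (srw_stationary G)) \<le> 1 / 4}"

end

theory Submission
  imports Defs
begin

text \<open>
  The spectral gap of a bounded degree planar graph on \<open>N\<close> vertices is \<open>O(1 / N)\<close>, so a fast mixing
  triangulation has to be thin. We use a flattened tube of length \<open>D\<close> whose circumference doubles every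
  \<open>L \<approx> D / log D\<close> levels, up to \<open>\<surd>L\<close>. Towards the wide end the walk has drift of order \<open>1 / L\<close>, and
  a discrete Hardy inequality gives a spectral gap of order \<open>1 / L\<^sup>2\<close>; since \<open>\<surd>L\<close> is small, the
  transversal direction costs nothing. The number of vertices is polynomial in \<open>D\<close>, so the mixing time is
  \<open>O(L\<^sup>2 log D) = O(D\<^sup>2 / log D)\<close>. As every edge lies in a triangle, the spectrum also stays
  away from \<open>-1\<close>.

  The tube is the double of a triangulated strip. The strip has an affine bijection onto a square, given
  by the level and the relative position within the level, which makes the double a pillow, hence a sphere.
\<close>

section \<open>Mixing from a Poincare inequality\<close>

text \<open>One integer \<open>m\<close> ties the parameters together: \<open>m\<close> blocks of
  \<open>L = 4 ^ m\<close> levels make the length about \<open>m * L\<close> and the widest level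
  \<open>2 * 2 ^ m\<close> vertices. A gap of order 1/L^2 and a volume exponential in
  \<open>m\<close> give mixing time O(m L^2), that is O(J^2 / m), and \<open>J \<le> 8 ^ m\<close>
  turns \<open>m\<close> into \<open>ln J\<close>. Edges within a level are used only on the widest
  level, where they cost a factor of order L (n J)^2; this is why the width must stay O(sqrt L).
  Doubling a strip avoids capping off a tube and reduces the work to one disc. The Poincare
  inequality is proved on a single sheet, relative to any base vertex of the top level; taking a
  corner common to both sheets as base vertex then joins the two estimates. The same inequality also
  supplies connectedness and uniqueness of the stationary distribution, so neither is
  assumed.\<close>

locale triangular_walk =
  fixes V :: "'a set" and N :: "'a \<Rightarrow> 'a set" and dm Kp :: real
  assumes finV: "finite V" and V_ne: "V \<noteq> {}"
    and N_sub: "x \<in> V \<Longrightarrow> N x \<subseteq> V"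
    and N_sym: "x \<in> V \<Longrightarrow> y \<in> N x \<Longrightarrow> x \<in> N y"
    and N_ne: "x \<in> V \<Longrightarrow> N x \<noteq> {}"
    and deg_le: "x \<in> V \<Longrightarrow> real (card (N x)) \<le> dm"
    and triangle: "x \<in> V \<Longrightarrow> y \<in> N x \<Longrightarrow> N x \<inter> N y \<noteq> {}"
    and poincare: "\<exists>c. (\<Sum>x\<in>V. real (card (N x)) * (f x - c)\<^sup>2)
                       \<le> Kp * (\<Sum>x\<in>V. \<Sum>y\<in>N x. (f x - f y)\<^sup>2)"
    and dm_le: "dm \<le> Kp"
begin

definition dg :: "'a \<Rightarrow> real" where "dg x = real (card (N x))"
definition vol :: real where "vol = (\<Sum>x\<in>V. dg x)"
definition ip :: "('a \<Rightarrow> real) \<Rightarrow> ('a \<Rightarrow> real) \<Rightarrow> real" where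
  "ip f g = (\<Sum>x\<in>V. dg x * f x * g x)"
definition P :: "('a \<Rightarrow> real) \<Rightarrow> 'a \<Rightarrow> real" where
  "P f x = (\<Sum>y\<in>N x. f y) / dg x"
text \<open>The contraction rate of \<open>P\<close> on functions of mean zero. The 2 appears
  because the energy sums every edge in both orientations and so equals
  \<open>2 * (ip f f - ip f (P f))\<close>.\<close>

definition \<rho> :: real where "\<rho> = 1 - 1 / (2 * Kp)"

lemma finN: "x \<in> V \<Longrightarrow> finite (N x)"
  using N_sub finV finite_subset by blast

lemma dg_ge1: "x \<in> V \<Longrightarrow> dg x \<ge> 1"
  unfolding dg_def using finN N_ne by (metis card_0_eq less_one not_le of_nat_1 of_nat_le_iff)

lemma Kp_ge1: "Kp \<ge> 1"
proof -
  obtain x where "x \<in> V" using V_ne by auto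
  with dg_ge1[of x] deg_le[of x] dm_le show ?thesis by (simp add: dg_def)
qed

lemma dm_ge1: "dm \<ge> 1"
proof -
  obtain x where "x \<in> V" using V_ne by auto
  with dg_ge1[of x] deg_le[of x] show ?thesis by (simp add: dg_def)
qed

lemma rho_bounds: "0 < \<rho>" "\<rho> < 1"
  using Kp_ge1 by (auto simp: \<rho>_def field_simps)

lemma vol_pos: "vol > 0"
  unfolding vol_def using dg_ge1 finV V_ne by (intro sum_pos) (auto intro: less_le_trans[OF zero_less_one])

lemma sum_arcs_swap: "(\<Sum>x\<in>V. \<Sum>y\<in>N x. h x y) = (\<Sum>x\<in>V. \<Sum>y\<in>N x. (h y x :: real))"
proof -
  have 1: "(\<Sum>x\<in>V. \<Sum>y\<in>N x. g x y) = (\<Sum>x\<in>V. \<Sum>y\<in>V. if y \<in> N x then g x y else 0)" for g :: "_ \<Rightarrow> _ \<Rightarrow> real"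
    by (intro sum.cong refl sum.mono_neutral_cong_left finV) (use N_sub in auto)
  have "(\<Sum>x\<in>V. \<Sum>y\<in>V. if y \<in> N x then h x y else 0) = (\<Sum>y\<in>V. \<Sum>x\<in>V. if y \<in> N x then h x y else 0)"
    by (rule sum.swap)
  also have "\<dots> = (\<Sum>y\<in>V. \<Sum>x\<in>V. if x \<in> N y then h x y else 0)"
    by (intro sum.cong refl if_cong) (use N_sym in blast)
  finally show ?thesis by (simp add: 1)
qed

lemma ip_P: "ip f (P g) = (\<Sum>x\<in>V. \<Sum>y\<in>N x. f x * g y)"
  unfolding ip_def P_def
proof (intro sum.cong refl)
  fix x assume "x \<in> V"
  then have "dg x \<noteq> 0" using dg_ge1[of x] by auto
  then show "dg x * f x * ((\<Sum>y\<in>N x. g y) / dg x) = (\<Sum>y\<in>N x. f x * g y)"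
    by (simp add: sum_distrib_left[symmetric])
qed

lemma ip_P_sym: "ip f (P g) = ip (P f) g"
proof -
  have "ip f (P g) = ip g (P f)"
    unfolding ip_P by (subst sum_arcs_swap) (simp add: mult.commute)
  then show ?thesis unfolding ip_def by (simp add: mult_ac)
qed

lemma sum_deg: "(\<Sum>x\<in>V. \<Sum>y\<in>N x. h x) = (\<Sum>x\<in>V. dg x * h x)"
  by (simp add: dg_def)

lemma sum_deg': "(\<Sum>x\<in>V. \<Sum>y\<in>N x. h y) = (\<Sum>x\<in>V. dg x * h x)"
  by (subst sum_arcs_swap) (simp add: dg_def)

lemma dirichlet_diff: "(\<Sum>x\<in>V. \<Sum>y\<in>N x. (f x - f y)\<^sup>2) = 2 * (ip f f - ip f (P f))"
proof -
  have "(\<Sum>x\<in>V. \<Sum>y\<in>N x. (f x - f y)\<^sup>2)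
      = (\<Sum>x\<in>V. \<Sum>y\<in>N x. (f x)\<^sup>2) + (\<Sum>x\<in>V. \<Sum>y\<in>N x. (f y)\<^sup>2) - 2 * (\<Sum>x\<in>V. \<Sum>y\<in>N x. f x * f y)"
    by (simp add: power2_diff sum.distrib sum_subtractf sum_distrib_left mult_ac)
  then show ?thesis unfolding sum_deg sum_deg' ip_P by (simp add: ip_def power2_eq_square mult_ac)
qed

lemma dirichlet_sum: "(\<Sum>x\<in>V. \<Sum>y\<in>N x. (f x + f y)\<^sup>2) = 2 * (ip f f + ip f (P f))"
proof -
  have "(\<Sum>x\<in>V. \<Sum>y\<in>N x. (f x + f y)\<^sup>2)
      = (\<Sum>x\<in>V. \<Sum>y\<in>N x. (f x)\<^sup>2) + (\<Sum>x\<in>V. \<Sum>y\<in>N x. (f y)\<^sup>2) + 2 * (\<Sum>x\<in>V. \<Sum>y\<in>N x. f x * f y)"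
    by (simp add: power2_sum sum.distrib sum_distrib_left mult_ac)
  then show ?thesis unfolding sum_deg sum_deg' ip_P by (simp add: ip_def power2_eq_square mult_ac)
qed

text \<open>Ordered triangles are permuted by cyclic relabelling. Hence a sum attached to one edge
  or vertex of a triangle can be replaced by a third of the sum over all three.\<close>

lemma sum_triangles_rotate:
  "(\<Sum>x\<in>V. \<Sum>y\<in>N x. \<Sum>z\<in>N x \<inter> N y. h x y z) = (\<Sum>x\<in>V. \<Sum>y\<in>N x. \<Sum>z\<in>N x \<inter> N y. (h z x y :: real))"
proof -
  have 1: "(\<Sum>x\<in>V. \<Sum>y\<in>N x. \<Sum>z\<in>N x \<inter> N y. g x y z)
     = (\<Sum>x\<in>V. \<Sum>y\<in>V. \<Sum>z\<in>V. if y \<in> N x \<and> z \<in> N x \<and> z \<in> N y then g x y z else 0)"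
    for g :: "_ \<Rightarrow> _ \<Rightarrow> _ \<Rightarrow> real"
  proof (rule sum.cong[OF refl])
    fix x assume x: "x \<in> V"
    have "(\<Sum>y\<in>V. \<Sum>z\<in>V. if y \<in> N x \<and> z \<in> N x \<and> z \<in> N y then g x y z else 0)
        = (\<Sum>y\<in>N x. \<Sum>z\<in>V. if z \<in> N x \<and> z \<in> N y then g x y z else 0)"
      by (rule sum.mono_neutral_cong_right) (use N_sub[OF x] finV in auto)
    also have "\<dots> = (\<Sum>y\<in>N x. \<Sum>z\<in>N x \<inter> N y. g x y z)"
      by (intro sum.cong refl sum.mono_neutral_cong_right) (use N_sub[OF x] finV in auto)
    finally show "(\<Sum>y\<in>N x. \<Sum>z\<in>N x \<inter> N y. g x y z)
      = (\<Sum>y\<in>V. \<Sum>z\<in>V. if y \<in> N x \<and> z \<in> N x \<and> z \<in> N y then g x y z else 0)" by simp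
  qed
  have "(\<Sum>x\<in>V. \<Sum>y\<in>V. \<Sum>z\<in>V. if y \<in> N x \<and> z \<in> N x \<and> z \<in> N y then h x y z else 0)
      = (\<Sum>y\<in>V. \<Sum>x\<in>V. \<Sum>z\<in>V. if y \<in> N x \<and> z \<in> N x \<and> z \<in> N y then h x y z else 0)"
    by (rule sum.swap)
  also have "\<dots> = (\<Sum>y\<in>V. \<Sum>z\<in>V. \<Sum>x\<in>V. if y \<in> N x \<and> z \<in> N x \<and> z \<in> N y then h x y z else 0)"
    by (rule sum.cong[OF refl], rule sum.swap)
  also have "\<dots> = (\<Sum>y\<in>V. \<Sum>z\<in>V. \<Sum>x\<in>V. if z \<in> N y \<and> x \<in> N y \<and> x \<in> N z then h x y z else 0)"
    by (intro sum.cong refl if_cong) (use N_sym in blast)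
  finally show ?thesis by (simp add: 1)
qed

text \<open>Since \<open>(a + b)\<^sup>2 + (b + c)\<^sup>2 + (c + a)\<^sup>2 \<ge> a\<^sup>2 + b\<^sup>2 + c\<^sup>2\<close>, having every edge in a triangle
  keeps the spectrum away from \<open>-1\<close>.\<close>
lemma lower_form: "ip f f \<le> dm * (2 * (ip f f + ip f (P f)))"
proof -
  let ?T = "\<lambda>h :: 'a \<Rightarrow> 'a \<Rightarrow> 'a \<Rightarrow> real. (\<Sum>x\<in>V. \<Sum>y\<in>N x. \<Sum>z\<in>N x \<inter> N y. h x y z)"
  have rot: "?T (\<lambda>x y z. h x y z) = ?T (\<lambda>x y z. h z x y)" for h
    by (rule sum_triangles_rotate)
  have add: "?T (\<lambda>x y z. h x y z + k x y z) = ?T h + ?T k" for h k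
    by (simp add: sum.distrib)
  have "ip f f = (\<Sum>x\<in>V. \<Sum>y\<in>N x. (f x)\<^sup>2)"
    unfolding sum_deg ip_def by (simp add: power2_eq_square mult_ac)
  also have "\<dots> \<le> ?T (\<lambda>x y z. (f x)\<^sup>2)"
  proof (intro sum_mono)
    fix x y assume "x \<in> V" "y \<in> N x"
    then have "card (N x \<inter> N y) \<ge> 1"
      using triangle finN by (metis card_0_eq finite_Int less_one not_le)
    then have "1 * (f x)\<^sup>2 \<le> real (card (N x \<inter> N y)) * (f x)\<^sup>2" by (intro mult_right_mono) auto
    then show "(f x)\<^sup>2 \<le> (\<Sum>z\<in>N x \<inter> N y. (f x)\<^sup>2)" by simp
  qed
  finally have 1: "ip f f \<le> ?T (\<lambda>x y z. (f x)\<^sup>2)" .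
  have "3 * ?T (\<lambda>x y z. (f x)\<^sup>2) = ?T (\<lambda>x y z. (f x)\<^sup>2 + (f y)\<^sup>2 + (f z)\<^sup>2)"
    unfolding add using rot[of "\<lambda>x y z. (f x)\<^sup>2"] rot[of "\<lambda>x y z. (f z)\<^sup>2"] by simp
  also have "\<dots> \<le> ?T (\<lambda>x y z. (f x + f y)\<^sup>2 + (f y + f z)\<^sup>2 + (f z + f x)\<^sup>2)"
  proof (intro sum_mono)
    fix x y z
    have "(f x + f y)\<^sup>2 + (f y + f z)\<^sup>2 + (f z + f x)\<^sup>2
        = (f x)\<^sup>2 + (f y)\<^sup>2 + (f z)\<^sup>2 + (f x + f y + f z)\<^sup>2" by (simp add: power2_eq_square algebra_simps)
    then show "(f x)\<^sup>2 + (f y)\<^sup>2 + (f z)\<^sup>2 \<le> (f x + f y)\<^sup>2 + (f y + f z)\<^sup>2 + (f z + f x)\<^sup>2" by simp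
  qed
  also have "\<dots> = 3 * ?T (\<lambda>x y z. (f x + f y)\<^sup>2)"
    unfolding add using rot[of "\<lambda>x y z. (f x + f y)\<^sup>2"] rot[of "\<lambda>x y z. (f y + f z)\<^sup>2"]
      rot[of "\<lambda>x y z. (f z + f x)\<^sup>2"] by simp
  also have "?T (\<lambda>x y z. (f x + f y)\<^sup>2) \<le> (\<Sum>x\<in>V. \<Sum>y\<in>N x. dm * (f x + f y)\<^sup>2)"
  proof (intro sum_mono)
    fix x y assume x: "x \<in> V" "y \<in> N x"
    have "card (N x \<inter> N y) \<le> card (N x)" using finN[OF x(1)] by (intro card_mono) auto
    then have "real (card (N x \<inter> N y)) \<le> dm" using deg_le[OF x(1)] by linarith
    then show "(\<Sum>z\<in>N x \<inter> N y. (f x + f y)\<^sup>2) \<le> dm * (f x + f y)\<^sup>2"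
      by (simp add: mult_right_mono)
  qed
  also have "\<dots> = dm * (2 * (ip f f + ip f (P f)))"
    unfolding dirichlet_sum[symmetric] by (simp add: sum_distrib_left)
  finally show ?thesis using 1 by simp
qed

lemma ip_nonneg: "ip f f \<ge> 0"
  unfolding ip_def dg_def by (intro sum_nonneg) (simp add: mult.assoc)

lemma ip_lin: "ip (\<lambda>x. a * f x + b * g x) h = a * ip f h + b * ip g h"
  unfolding ip_def by (simp add: algebra_simps sum.distrib sum_distrib_left)

lemma ip_commute: "ip f g = ip g f" unfolding ip_def by (simp add: mult_ac)

lemma P_lin: "P (\<lambda>x. a * f x + b * g x) x = a * P f x + b * P g x"
  unfolding P_def by (simp add: sum.distrib sum_distrib_left add_divide_distrib)

lemma mean_P: "(\<Sum>x\<in>V. dg x * P f x) = (\<Sum>x\<in>V. dg x * f x)"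
proof -
  have "(\<Sum>x\<in>V. dg x * P f x) = ip (\<lambda>_. 1) (P f)" by (simp add: ip_def)
  also have "\<dots> = (\<Sum>x\<in>V. dg x * f x)" by (simp add: ip_P sum_deg')
  finally show ?thesis .
qed

text \<open>For \<open>f\<close> of mean zero the squared deviation from a constant is smallest at
  0, so whatever \<open>c\<close> the Poincare inequality provides, \<open>ip f f\<close> is
  controlled. This bounds the form from above; triangles bound it from below with \<open>dm\<close>
  in place of \<open>Kp\<close>, and \<open>dm_le\<close> lets one rate serve both.\<close>

lemma form_bound:
  assumes f0: "(\<Sum>x\<in>V. dg x * f x) = 0"
  shows "\<bar>ip f (P f)\<bar> \<le> \<rho> * ip f f"
proof -
  obtain c where c: "(\<Sum>x\<in>V. dg x * (f x - c)\<^sup>2) \<le> Kp * (2 * (ip f f - ip f (P f)))"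
    using poincare[of f] unfolding dg_def[symmetric] dirichlet_diff by blast
  have "(\<Sum>x\<in>V. dg x * (f x - c)\<^sup>2) = ip f f - 2 * c * (\<Sum>x\<in>V. dg x * f x) + c\<^sup>2 * vol"
    unfolding ip_def vol_def
    by (simp add: power2_eq_square algebra_simps sum.distrib sum_subtractf sum_distrib_left)
  then have "ip f f \<le> (\<Sum>x\<in>V. dg x * (f x - c)\<^sup>2)"
    using f0 vol_pos by simp
  with c have 1: "ip f f \<le> Kp * (2 * (ip f f - ip f (P f)))" by linarith
  have "dm * (2 * (ip f f + ip f (P f))) \<le> Kp * (2 * (ip f f + ip f (P f)))"
  proof (rule mult_right_mono[OF dm_le])
    have "0 \<le> dm * (2 * (ip f f + ip f (P f)))" using lower_form[of f] ip_nonneg[of f] by linarith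
    then show "0 \<le> 2 * (ip f f + ip f (P f))" using dm_ge1 by (simp add: zero_le_mult_iff)
  qed
  with lower_form[of f] have 2: "ip f f \<le> Kp * (2 * (ip f f + ip f (P f)))" by linarith
  from 1 2 show ?thesis
    using Kp_ge1 unfolding \<rho>_def abs_le_iff by (auto simp: field_simps)
qed

text \<open>Polarization turns the bound on the quadratic form of the self-adjoint operator into a bound on its norm.\<close>
lemma norm_P:
  assumes f0: "(\<Sum>x\<in>V. dg x * f x) = 0"
  shows "ip (P f) (P f) \<le> \<rho>\<^sup>2 * ip f f"
proof -
  \<comment> \<open>This scaling balances the polarized bound: with a the squared norm of
    \<open>P f\<close> it reads 4 a / \<rho> \<le> 2 \<rho> (squared norm of f) + 2 a / \<rho>,
    which is the claim.\<close>
  define g where "g x = P f x / \<rho>" for x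
  have g0: "(\<Sum>x\<in>V. dg x * g x) = 0"
    using f0 mean_P[of f] unfolding g_def by (simp add: sum_divide_distrib[symmetric])
  let ?a = "\<lambda>x. 1 * f x + 1 * g x" and ?b = "\<lambda>x. 1 * f x + (-1) * g x"
  have a0: "(\<Sum>x\<in>V. dg x * ?a x) = 0" "(\<Sum>x\<in>V. dg x * ?b x) = 0"
    using f0 g0 by (simp_all add: algebra_simps sum.distrib sum_subtractf)
  have Pa: "P ?a = (\<lambda>x. 1 * P f x + 1 * P g x)" "P ?b = (\<lambda>x. 1 * P f x + (-1) * P g x)"
    by (intro ext P_lin)+
  have e: "ip ?a (P ?a) - ip ?b (P ?b) = 2 * ip f (P g) + 2 * ip g (P f)"
    unfolding Pa ip_lin ip_commute[of _ "\<lambda>x. _ * _ x + _ * _ x"]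
    using ip_commute[of "P g" f] ip_commute[of "P f" g] by simp
  have i: "ip ?a ?a + ip ?b ?b = 2 * ip f f + 2 * ip g g"
    unfolding ip_lin ip_commute[of _ "\<lambda>x. _ * _ x + _ * _ x"] by simp
  have "ip f (P g) = ip g (P f)" using ip_P_sym[of f g] ip_commute by simp
  then have "4 * ip g (P f) \<le> \<rho> * (2 * ip f f + 2 * ip g g)"
    using form_bound[OF a0(1)] form_bound[OF a0(2)] e i[symmetric] by (simp add: abs_le_iff distrib_left)
  moreover have "ip g (P f) = ip (P f) (P f) / \<rho>" "ip g g = ip (P f) (P f) / \<rho>\<^sup>2"
    unfolding ip_def g_def by (simp_all add: sum_divide_distrib power2_eq_square)
  ultimately show ?thesis using rho_bounds by (simp add: field_simps power2_eq_square)
qed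

lemma mean_P_iter: "(\<Sum>x\<in>V. dg x * (P ^^ t) f x) = (\<Sum>x\<in>V. dg x * f x)"
  by (induction t) (simp_all add: mean_P)

lemma norm_P_iter:
  assumes f0: "(\<Sum>x\<in>V. dg x * f x) = 0"
  shows "ip ((P ^^ t) f) ((P ^^ t) f) \<le> \<rho> ^ (2 * t) * ip f f"
proof (induction t)
  case (Suc t)
  have "ip ((P ^^ Suc t) f) ((P ^^ Suc t) f) \<le> \<rho>\<^sup>2 * ip ((P ^^ t) f) ((P ^^ t) f)"
    using norm_P[of "(P ^^ t) f"] f0 by (simp add: mean_P_iter)
  also have "\<dots> \<le> \<rho>\<^sup>2 * (\<rho> ^ (2 * t) * ip f f)" using Suc by (intro mult_left_mono) auto
  finally show ?case by (simp add: power2_eq_square mult_ac)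
qed simp

lemma P_const: "x \<in> V \<Longrightarrow> P (\<lambda>_. c) x = c"
  using dg_ge1[of x] by (auto simp: P_def dg_def)

lemma P_cong: "x \<in> V \<Longrightarrow> (\<And>y. y \<in> V \<Longrightarrow> f y = g y) \<Longrightarrow> P f x = P g x"
  unfolding P_def using N_sub by (intro arg_cong2[where f = "(/)"] sum.cong) auto

lemma P_iter_shift: "x \<in> V \<Longrightarrow> (P ^^ t) (\<lambda>y. f y - c) x = (P ^^ t) f x - c"
proof (induction t arbitrary: x)
  case (Suc t)
  have "(P ^^ Suc t) (\<lambda>y. f y - c) x = P (\<lambda>y. 1 * (P ^^ t) f y + (-1) * c) x"
    using Suc by (auto intro!: P_cong)
  also have "\<dots> = 1 * P ((P ^^ t) f) x + (-1) * P (\<lambda>_. c) x" by (rule P_lin)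
  finally show ?case using Suc.prems by (simp add: P_const)
qed simp

text \<open>Centring \<open>f\<close> leaves squared norm at most \<open>vol\<close>, which then
  contracts; a single vertex is read off the weighted norm because its degree is at least 1. The
  factor \<open>sqrt vol\<close> is the source of the logarithm of the number of vertices in the
  mixing time.\<close>

lemma uniform_mixing:
  assumes x: "x \<in> V" and A: "\<And>y. 0 \<le> f y \<and> f y \<le> (1::real)"
  shows "\<bar>(P ^^ t) f x - (\<Sum>y\<in>V. dg y * f y) / vol\<bar> \<le> \<rho> ^ t * sqrt vol"
proof -
  define m where "m = (\<Sum>y\<in>V. dg y * f y) / vol"
  let ?f = "\<lambda>y. f y - m"
  have "(\<Sum>y\<in>V. dg y * ?f y) = (\<Sum>y\<in>V. dg y * f y) - m * vol"
    by (simp add: vol_def algebra_simps sum_subtractf sum_distrib_left)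
  then have f0: "(\<Sum>y\<in>V. dg y * ?f y) = 0" using vol_pos by (simp add: m_def)
  have "0 \<le> (\<Sum>y\<in>V. dg y * f y)" using A by (intro sum_nonneg) (auto simp: dg_def)
  moreover have "(\<Sum>y\<in>V. dg y * f y) \<le> (\<Sum>y\<in>V. dg y * 1)"
    using A by (intro sum_mono mult_left_mono) (auto simp: dg_def)
  ultimately have m01: "0 \<le> m" "m \<le> 1" using vol_pos by (auto simp: m_def vol_def field_simps)
  have "ip ?f ?f \<le> vol"
    unfolding ip_def vol_def
  proof (intro sum_mono)
    fix y assume "y \<in> V"
    have "\<bar>f y - m\<bar> \<le> 1" using A[of y] m01 by linarith
    then have "(f y - m)\<^sup>2 \<le> 1" by (simp add: abs_square_le_1)
    then have "dg y * (f y - m)\<^sup>2 \<le> dg y * 1" by (intro mult_left_mono) (auto simp: dg_def)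
    then show "dg y * (f y - m) * (f y - m) \<le> dg y" by (simp add: power2_eq_square mult_ac)
  qed
  then have 1: "ip ((P ^^ t) ?f) ((P ^^ t) ?f) \<le> \<rho> ^ (2 * t) * vol"
    using norm_P_iter[OF f0, of t] rho_bounds by (meson mult_left_mono order_trans zero_le_power less_imp_le)
  have "((P ^^ t) ?f x)\<^sup>2 \<le> dg x * ((P ^^ t) ?f x)\<^sup>2"
    using dg_ge1[OF x] by (simp add: mult_right_mono[of 1 "dg x", simplified])
  also have "\<dots> \<le> (\<Sum>y\<in>V. dg y * ((P ^^ t) ?f y)\<^sup>2)"
    by (rule member_le_sum[OF x]) (auto simp: finV dg_def)
  also have "\<dots> = ip ((P ^^ t) ?f) ((P ^^ t) ?f)" by (simp add: ip_def power2_eq_square mult_ac)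
  finally have "((P ^^ t) ?f x)\<^sup>2 \<le> \<rho> ^ (2 * t) * vol" using 1 by linarith
  also have "\<dots> = (\<rho> ^ t * sqrt vol)\<^sup>2" using vol_pos by (simp only: power_mult_distrib power_even_eq real_sqrt_pow2[OF less_imp_le])
  finally have "\<bar>(P ^^ t) ?f x\<bar> \<le> \<bar>\<rho> ^ t * sqrt vol\<bar>" by (simp only: abs_le_square_iff)
  also have "\<dots> = \<rho> ^ t * sqrt vol" using rho_bounds vol_pos by (intro abs_of_nonneg mult_nonneg_nonneg) auto
  finally show ?thesis using P_iter_shift[OF x] by (simp add: m_def)
qed

end

section \<open>From the averaging operator to total variation and mixing time\<close>

locale triangular_graph = triangular_walk +
  fixes G :: "('a, 'b) pre_digraph"
  assumes verts_G: "verts G = V"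
    and step: "x \<in> V \<Longrightarrow> pmf (srw_step G x) y = (if y \<in> N x then 1 / real (card (N x)) else 0)"
begin

lemma set_step: "x \<in> V \<Longrightarrow> set_pmf (srw_step G x) = N x"
  using dg_ge1[of x] by (auto simp: set_pmf_iff step dg_def split: if_splits)

lemma srw_Suc: "srw G (Suc t) x = bind_pmf (srw G t x) (srw_step G)"
  by (simp add: srw_def)

lemma set_bind: "set_pmf p \<subseteq> V \<Longrightarrow> set_pmf (bind_pmf p (srw_step G)) \<subseteq> V"
  using set_step N_sub by (simp add: UN_least subsetD)

lemma set_srw: "x \<in> V \<Longrightarrow> set_pmf (srw G t x) \<subseteq> V"
proof (induction t)
  case 0
  then show ?case by (simp add: srw_def)
next
  case (Suc t)
  then show ?case using set_bind[of "srw G t x"] by (simp add: srw_Suc)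
qed

text \<open>Duality: moving a distribution one step is the same as applying \<open>P\<close> to the
  test function.\<close>

lemma sum_bind_step:
  assumes p: "set_pmf p \<subseteq> V"
  shows "(\<Sum>y\<in>V. pmf (bind_pmf p (srw_step G)) y * f y) = (\<Sum>x\<in>V. pmf p x * P f x)"
proof -
  have "(\<Sum>y\<in>V. pmf (bind_pmf p (srw_step G)) y * f y)
      = (\<Sum>y\<in>V. \<Sum>x\<in>V. pmf (srw_step G x) y * pmf p x * f y)"
    using p by (simp add: pmf_bind integral_measure_pmf_real[OF finV] subset_eq sum_distrib_right)
  also have "\<dots> = (\<Sum>x\<in>V. \<Sum>y\<in>V. pmf (srw_step G x) y * pmf p x * f y)" by (rule sum.swap)
  also have "\<dots> = (\<Sum>x\<in>V. pmf p x * P f x)"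
  proof (rule sum.cong[OF refl])
    fix x assume x: "x \<in> V"
    have "(\<Sum>y\<in>V. pmf (srw_step G x) y * pmf p x * f y) = (\<Sum>y\<in>N x. 1 / dg x * pmf p x * f y)"
      by (rule sum.mono_neutral_cong_right) (use x N_sub finV in \<open>auto simp: step dg_def\<close>)
    then show "(\<Sum>y\<in>V. pmf (srw_step G x) y * pmf p x * f y) = pmf p x * P f x"
      by (simp add: P_def sum_distrib_left sum_divide_distrib)
  qed
  finally show ?thesis .
qed

lemma srw_expectation: "x \<in> V \<Longrightarrow> (\<Sum>y\<in>V. pmf (srw G t x) y * f y) = (P ^^ t) f x"
proof (induction t arbitrary: f)
  case 0
  have "(\<Sum>y\<in>V. pmf (srw G 0 x) y * f y) = (\<Sum>y\<in>V. if y = x then f y else 0)"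
    by (intro sum.cong) (auto simp: srw_def pmf_return)
  then show ?case using 0 finV by simp
next
  case (Suc t)
  then show ?case
    using sum_bind_step[OF set_srw[OF Suc.prems]] by (simp add: srw_Suc funpow_swap1)
qed

lemma prob_eq_sum:
  assumes "set_pmf p \<subseteq> V"
  shows "measure_pmf.prob p A = (\<Sum>y\<in>V. pmf p y * indicator A y)"
proof -
  have "measure_pmf.prob p A = measure_pmf.prob p (A \<inter> V)"
    by (rule measure_pmf.finite_measure_eq_AE)
      (use assms in \<open>auto simp: AE_measure_pmf_iff\<close>)
  also have "\<dots> = (\<Sum>y\<in>A \<inter> V. pmf p y)" using finV by (simp add: measure_measure_pmf_finite)
  also have "\<dots> = (\<Sum>y\<in>V. pmf p y * indicator A y)"
    using finV by (intro sum.mono_neutral_cong_left) (auto simp: indicator_def)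
  finally show ?thesis .
qed

lemma card_arcs: "real (card (Sigma V N)) = vol"
  using finV finN by (simp add: vol_def dg_def)

text \<open>\<open>srw_stationary\<close> is a definite description, so both existence and
  uniqueness of the invariant distribution are needed before anything can be said about it.\<close>

lemma stationary_eq: "set_pmf (srw_stationary G) \<subseteq> V" "x \<in> V \<Longrightarrow> pmf (srw_stationary G) x = dg x / vol"
proof -
  have fin: "finite (Sigma V N)" using finV finN by auto
  have ne: "Sigma V N \<noteq> {}" using V_ne N_ne by fastforce
  \<comment> \<open>The tail of a uniformly random arc has weights proportional to the degrees, and
    its total mass needs no check.\<close>
  define q where "q = map_pmf fst (pmf_of_set (Sigma V N))"
  have set_q: "set_pmf q \<subseteq> V" using fin ne by (auto simp: q_def)
  have pmf_q: "pmf q x = dg x / vol" if x: "x \<in> V" for x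
  proof -
    have "Sigma V N \<inter> fst -` {x} = Pair x ` N x" using x by auto
    moreover have "card (Pair x ` N x) = card (N x)" by (intro card_image) (auto simp: inj_on_def)
    ultimately show ?thesis
      unfolding q_def pmf_map measure_pmf_of_set[OF ne fin] card_arcs by (simp add: dg_def)
  qed
  have sum_q: "(\<Sum>x\<in>V. pmf q x * h x) = (\<Sum>x\<in>V. dg x * h x) / vol" for h
    by (simp add: pmf_q sum_divide_distrib)
  have eqI: "p = p'" if "set_pmf p \<subseteq> V" "set_pmf p' \<subseteq> V" "\<And>x. x \<in> V \<Longrightarrow> pmf p x = pmf p' x" for p p' :: "'a pmf"
  proof (rule pmf_eqI)
    fix x show "pmf p x = pmf p' x"
      using that pmf_eq_0_set_pmf[of p x] pmf_eq_0_set_pmf[of p' x] by (cases "x \<in> V") auto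
  qed
  have delta: "(\<Sum>y\<in>V. h y * (if y = x then 1 else 0)) = h x" if "x \<in> V" for h :: "'a \<Rightarrow> real" and x
    using that finV by (simp add: if_distrib cong: if_cong)
  have inv_q: "bind_pmf q (srw_step G) = q"
  proof (rule eqI[OF set_bind[OF set_q] set_q])
    fix x assume x: "x \<in> V"
    let ?h = "\<lambda>y. if y = x then 1 else 0 :: real"
    have "pmf (bind_pmf q (srw_step G)) x = (\<Sum>y\<in>V. pmf q y * P ?h y)"
      using sum_bind_step[OF set_q, of ?h] delta[OF x] by simp
    also have "\<dots> = (\<Sum>y\<in>V. pmf q y * ?h y)" unfolding sum_q mean_P ..
    finally show "pmf (bind_pmf q (srw_step G)) x = pmf q x" using delta[OF x] by simp
  qed
  have uniq: "p = q" if p: "set_pmf p \<subseteq> V" "bind_pmf p (srw_step G) = p" for p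
  proof -
    \<comment> \<open>The density with respect to the degrees. Invariance of \<open>p\<close> makes
      its energy vanish, and the Poincare inequality then makes it constant.\<close>
    define g where "g x = pmf p x / dg x" for x
    have pg: "pmf p x = dg x * g x" if "x \<in> V" for x using dg_ge1[OF that] by (simp add: g_def)
    have "ip g (P g) = (\<Sum>x\<in>V. pmf p x * P g x)" by (auto simp: ip_def pg intro!: sum.cong)
    also have "\<dots> = (\<Sum>x\<in>V. pmf p x * g x)" using sum_bind_step[OF p(1), of g] p(2) by simp
    also have "\<dots> = ip g g" by (auto simp: ip_def pg intro!: sum.cong)
    finally have harm: "ip g g - ip g (P g) = 0" by simp
    obtain c where c: "(\<Sum>x\<in>V. dg x * (g x - c)\<^sup>2) \<le> Kp * (2 * (ip g g - ip g (P g)))"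
      using poincare[of g] unfolding dg_def[symmetric] dirichlet_diff by blast
    then have "(\<Sum>x\<in>V. dg x * (g x - c)\<^sup>2) \<le> 0" by (simp add: harm)
    moreover have "(\<Sum>x\<in>V. dg x * (g x - c)\<^sup>2) \<ge> 0" by (intro sum_nonneg) (auto simp: dg_def)
    ultimately have "(\<Sum>x\<in>V. dg x * (g x - c)\<^sup>2) = 0" by linarith
    then have "\<And>x. x \<in> V \<Longrightarrow> dg x * (g x - c)\<^sup>2 = 0"
      using finV by (subst (asm) sum_nonneg_eq_0_iff) (auto simp: dg_def)
    then have gc: "g x = c" if "x \<in> V" for x using dg_ge1[OF that] that by fastforce
    have "1 = (\<Sum>x\<in>V. pmf p x)" using sum_pmf_eq_1[OF finV p(1)] by simp
    also have "\<dots> = c * vol" by (simp add: vol_def pg gc sum_distrib_left mult_ac)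
    finally have "c = 1 / vol" using vol_pos by (simp add: field_simps)
    then show ?thesis by (intro eqI p(1) set_q) (simp add: pg gc pmf_q)
  qed
  have "srw_stationary G = q"
    unfolding srw_stationary_def verts_G
    by (rule the_equality, rule conjI[OF set_q inv_q], rule uniq, blast+)
  then show "set_pmf (srw_stationary G) \<subseteq> V" "x \<in> V \<Longrightarrow> pmf (srw_stationary G) x = dg x / vol"
    using set_q pmf_q by auto
qed

lemma total_variation_le:
  assumes x: "x \<in> V"
  shows "total_variation (srw G t x) (srw_stationary G) \<le> \<rho> ^ t * sqrt vol"
  unfolding total_variation_def
proof (rule cSUP_least)
  fix A :: "'a set"
  have "measure_pmf.prob (srw_stationary G) A = (\<Sum>y\<in>V. dg y * indicator A y) / vol"
    by (simp add: prob_eq_sum stationary_eq sum_divide_distrib)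
  moreover have "measure_pmf.prob (srw G t x) A = (P ^^ t) (indicator A) x"
    by (simp add: prob_eq_sum set_srw x srw_expectation)
  moreover have "\<bar>(P ^^ t) (indicator A) x - (\<Sum>y\<in>V. dg y * indicator A y) / vol\<bar> \<le> \<rho> ^ t * sqrt vol"
    by (rule uniform_mixing[OF x]) (simp add: indicator_def)
  ultimately show "\<bar>measure_pmf.prob (srw G t x) A - measure_pmf.prob (srw_stationary G) A\<bar> \<le> \<rho> ^ t * sqrt vol"
    by simp
qed simp

text \<open>By \<open>\<rho> \<le> exp (- 1 / (2 * Kp))\<close>, the assumed number of steps brings
  \<open>\<rho> ^ t\<close> below 1 / (4 sqrt B), which cancels \<open>sqrt vol\<close>; the 16 is
  the square of the 4 in the threshold 1/4.\<close>

lemma mixing_time_le: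
  assumes B: "real (card V) * dm \<le> B" and t: "Kp * ln (16 * B) \<le> real t"
  shows "mixing_time G \<le> enat t"
proof -
  have "vol \<le> (\<Sum>x\<in>V. dm)" unfolding vol_def dg_def by (intro sum_mono deg_le)
  then have vB: "vol \<le> B" using B by simp
  then have B0: "B > 0" using vol_pos by simp
  have "\<rho> \<le> exp (- (1 / (2 * Kp)))"
    using exp_ge_add_one_self[of "- (1 / (2 * Kp))"] by (simp add: \<rho>_def)
  then have "\<rho> ^ t \<le> exp (- (1 / (2 * Kp))) ^ t" using rho_bounds by (intro power_mono) auto
  also have "\<dots> = exp (- (real t / (2 * Kp)))" by (simp add: exp_of_nat_mult[symmetric])
  also have "\<dots> \<le> exp (- (ln (16 * B) / 2))" using t Kp_ge1 by (simp add: field_simps)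
  also have "\<dots> = 1 / (4 * sqrt B)"
  proof -
    have "exp (ln (16 * B) / 2) = sqrt (16 * B)"
      using B0 powr_half_sqrt[of "16 * B"] by (simp add: powr_def)
    then show ?thesis by (simp add: exp_minus real_sqrt_mult inverse_eq_divide)
  qed
  finally have "\<rho> ^ t * sqrt vol \<le> 1 / (4 * sqrt B) * sqrt B"
    using vB B0 vol_pos by (intro mult_mono) auto
  then have le: "\<rho> ^ t * sqrt vol \<le> 1 / 4" using B0 by simp
  have "(MAX x\<in>verts G. total_variation (srw G t x) (srw_stationary G)) \<le> 1 / 4"
    unfolding verts_G using finV V_ne order_trans[OF total_variation_le le] by (subst Max_le_iff) auto
  then have "enat t \<in> {enat t |t. (MAX x\<in>verts G. total_variation (srw G t x) (srw_stationary G)) \<le> 1 / 4}"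
    by blast
  then show ?thesis unfolding mixing_time_def by (rule Inf_lower)
qed

end

text \<open>The indicator of a closed set has zero energy, so the Poincare inequality makes it
  constant. This later gives finiteness of the diameter.\<close>

lemma (in triangular_walk) connected:
  assumes S: "S \<subseteq> V" "S \<noteq> {}" and closed: "\<And>x y. x \<in> S \<Longrightarrow> y \<in> N x \<Longrightarrow> y \<in> S"
  shows "S = V"
proof -
  let ?f = "indicator S :: 'a \<Rightarrow> real"
  have "?f x = ?f y" if "x \<in> V" "y \<in> N x" for x y
    using that closed[of x y] closed[of y x] N_sym[of x y] by (auto simp: indicator_def)
  then have E: "(\<Sum>x\<in>V. \<Sum>y\<in>N x. (?f x - ?f y)\<^sup>2) = 0" by simp
  obtain c where c: "(\<Sum>x\<in>V. real (card (N x)) * (?f x - c)\<^sup>2) \<le> 0"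
    using poincare[of ?f] unfolding E by auto
  have "(\<Sum>x\<in>V. dg x * (?f x - c)\<^sup>2) \<ge> 0" by (intro sum_nonneg) (auto simp: dg_def)
  then have "(\<Sum>x\<in>V. dg x * (?f x - c)\<^sup>2) = 0" using c by (simp add: dg_def)
  then have "\<And>x. x \<in> V \<Longrightarrow> dg x * (?f x - c)\<^sup>2 = 0"
    using finV by (subst (asm) sum_nonneg_eq_0_iff) (auto simp: dg_def)
  then have const: "?f x = c" if "x \<in> V" for x using dg_ge1[OF that] that by fastforce
  obtain s where "s \<in> S" using S by blast
  then have "c = 1" using const[of s] S by auto
  then have "x \<in> S" if "x \<in> V" for x using const[OF that] by (simp add: indicator_def split: if_splits)
  then show ?thesis using S by blast
qed

section \<open>Doubled discs\<close>

text \<open>The value at \<open>x\<close> of the affine extension of the vertex function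
  \<open>g\<close>.\<close>

definition bary_sum :: "'a set \<Rightarrow> ('a \<Rightarrow> real) \<Rightarrow> ('a \<Rightarrow> real) \<Rightarrow> real" where
  "bary_sum W g x = (\<Sum>v\<in>W. x v * g v)"

lemma realization_I:
  assumes "finite \<sigma>" "\<tau> \<in> K" "\<tau> = {v. x v \<noteq> 0}" "\<tau> \<subseteq> \<sigma>" "\<And>v. 0 \<le> x v" "(\<Sum>v\<in>\<sigma>. x v) = 1"
  shows "x \<in> geometric_realization K"
proof -
  have "(\<Sum>v\<in>\<tau>. x v) = (\<Sum>v\<in>\<sigma>. x v)" using assms by (intro sum.mono_neutral_left) auto
  then show ?thesis using assms by (simp add: geometric_realization_def)
qed

lemma realization_sum:
  assumes "x \<in> geometric_realization K" "finite W" "\<Union>K \<subseteq> W"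
  shows "(\<Sum>v\<in>W. x v) = 1"
proof -
  have "{v. x v \<noteq> 0} \<subseteq> W" using assms by (auto simp: geometric_realization_def)
  then have "(\<Sum>v\<in>{v. x v \<noteq> 0}. x v) = (\<Sum>v\<in>W. x v)" using assms(2) by (intro sum.mono_neutral_left) auto
  then show ?thesis using assms(1) by (simp add: geometric_realization_def)
qed

lemma realization_Un:
  "geometric_realization (A \<union> B) = geometric_realization A \<union> geometric_realization B"
  by (auto simp: geometric_realization_def)

text \<open>Each closed simplex is a closed subset of a product of compact intervals, which are
  degenerate off the simplex, so Tychonoff applies. Compactness will upgrade a continuous bijection
  to a homeomorphism.\<close>

lemma compact_realization:
  fixes K :: "'a set set"
  assumes fin: "finite K" and cx: "abstract_simplicial_complex K"
  shows "compact (geometric_realization K)"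
proof -
  let ?S = "\<lambda>\<sigma>. PiE UNIV (\<lambda>v. if v \<in> \<sigma> then {0..1} else {0::real}) \<inter> {x. (\<Sum>v\<in>\<sigma>. x v) = 1}"
  have comp: "compact (?S \<sigma>)" for \<sigma> :: "'a set"
  proof (rule compact_Int_closed)
    have "compactin (product_topology (\<lambda>i::'a. euclidean) UNIV) (PiE UNIV (\<lambda>v. if v \<in> \<sigma> then {0..1} else {0::real}))"
      unfolding compactin_PiE by auto
    then show "compact (PiE UNIV (\<lambda>v. if v \<in> \<sigma> then {0..1} else {0::real}))"
      by (simp add: euclidean_product_topology)
    show "closed {x :: 'a \<Rightarrow> real. (\<Sum>v\<in>\<sigma>. x v) = 1}"
      by (intro closed_Collect_eq continuous_intros continuous_on_product_coordinates)
  qed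
  have "geometric_realization K = (\<Union>\<sigma>\<in>K. ?S \<sigma>)"
  proof (intro equalityI subsetI)
    fix x assume x: "x \<in> geometric_realization K"
    let ?s = "{v. x v \<noteq> 0}"
    have s: "?s \<in> K" "\<forall>v. 0 \<le> x v" "(\<Sum>v\<in>?s. x v) = 1" using x by (auto simp: geometric_realization_def)
    then have fs: "finite ?s" using cx by (auto simp: abstract_simplicial_complex_def)
    have "x v \<le> 1" for v
    proof (cases "x v = 0")
      case False
      then have "x v \<le> (\<Sum>v\<in>?s. x v)" using fs s(2) by (intro member_le_sum) auto
      then show ?thesis using s by simp
    qed simp
    then have "x \<in> ?S ?s" using s by (auto simp: PiE_def Pi_def)
    then show "x \<in> (\<Union>\<sigma>\<in>K. ?S \<sigma>)" using s by blast
  next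
    fix x assume "x \<in> (\<Union>\<sigma>\<in>K. ?S \<sigma>)"
    then obtain \<sigma> where \<sigma>: "\<sigma> \<in> K" "x \<in> ?S \<sigma>" by blast
    have nonneg: "0 \<le> x v" and zero: "v \<notin> \<sigma> \<Longrightarrow> x v = 0" for v
      using \<sigma>(2) by (auto simp: PiE_def Pi_def split: if_splits dest: spec[of _ v])
    have sub: "{v. x v \<noteq> 0} \<subseteq> \<sigma>" using zero by blast
    have sum: "(\<Sum>v\<in>\<sigma>. x v) = 1" using \<sigma>(2) by simp
    then have "{v. x v \<noteq> 0} \<noteq> {}" by (auto intro: ccontr)
    then have "{v. x v \<noteq> 0} \<in> K" using cx \<sigma>(1) sub unfolding abstract_simplicial_complex_def by blast
    moreover have "finite \<sigma>" using cx \<sigma>(1) by (simp add: abstract_simplicial_complex_def)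
    ultimately show "x \<in> geometric_realization K"
      using sub nonneg sum by (intro realization_I[of \<sigma> "{v. x v \<noteq> 0}"]) simp_all
  qed
  then show ?thesis using fin comp by (simp add: compact_UN)
qed

text \<open>Barycentric coordinates are moved back along the vertex labelling, not forward: reading
  off \<open>x (\<iota> v)\<close> makes continuity in \<open>x\<close> immediate.\<close>

definition pull :: "'a set \<Rightarrow> ('a \<Rightarrow> 'b) \<Rightarrow> ('b \<Rightarrow> real) \<Rightarrow> 'a \<Rightarrow> real" where
  "pull W \<iota> x = (\<lambda>v. if v \<in> W then x (\<iota> v) else 0)"

lemma pull_support:
  assumes "{w. x w \<noteq> 0} \<subseteq> \<iota> ` W"
  shows "{w. x w \<noteq> 0} = \<iota> ` {v. pull W \<iota> x v \<noteq> 0}"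
  using assms by (auto simp: pull_def)

lemma realization_image_support:
  assumes "inj_on \<iota> W" "\<Union>T \<subseteq> W" "x \<in> geometric_realization ((`) \<iota> ` T)"
  shows "{v. pull W \<iota> x v \<noteq> 0} \<in> T" "{w. x w \<noteq> 0} = \<iota> ` {v. pull W \<iota> x v \<noteq> 0}"
proof -
  obtain \<sigma> where \<sigma>: "\<sigma> \<in> T" "{w. x w \<noteq> 0} = \<iota> ` \<sigma>"
    using assms(3) by (auto simp: geometric_realization_def)
  then have sW: "\<sigma> \<subseteq> W" using assms(2) by blast
  then show 1: "{w. x w \<noteq> 0} = \<iota> ` {v. pull W \<iota> x v \<noteq> 0}" using \<sigma> by (intro pull_support) auto
  have "{v. pull W \<iota> x v \<noteq> 0} \<subseteq> W" by (auto simp: pull_def)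
  then have "{v. pull W \<iota> x v \<noteq> 0} = \<sigma>" using 1 \<sigma>(2) sW assms(1) by (metis inj_on_image_eq_iff)
  then show "{v. pull W \<iota> x v \<noteq> 0} \<in> T" using \<sigma> by simp
qed

lemma bij_betw_pull:
  assumes inj: "inj_on \<iota> W" and sub: "\<Union>T \<subseteq> W"
  shows "bij_betw (pull W \<iota>) (geometric_realization ((`) \<iota> ` T)) (geometric_realization T)"
proof (rule bij_betw_imageI)
  let ?A = "geometric_realization ((`) \<iota> ` T)"
  show "inj_on (pull W \<iota>) ?A"
  proof (rule inj_onI)
    fix x y assume x: "x \<in> ?A" and y: "y \<in> ?A" and eq: "pull W \<iota> x = pull W \<iota> y"
    have s: "{w. x w \<noteq> 0} \<subseteq> \<iota> ` W" "{w. y w \<noteq> 0} \<subseteq> \<iota> ` W"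
      using realization_image_support(2)[OF inj sub x] realization_image_support(2)[OF inj sub y]
      by (auto simp: pull_def)
    show "x = y"
    proof
      fix w show "x w = y w"
      proof (cases "w \<in> \<iota> ` W")
        case True
        then obtain v where "v \<in> W" "w = \<iota> v" by blast
        then show ?thesis using fun_cong[OF eq, of v] by (simp add: pull_def)
      next
        case False
        then have "x w = 0" "y w = 0" using s by blast+
        then show ?thesis by simp
      qed
    qed
  qed
  show "pull W \<iota> ` ?A = geometric_realization T"
  proof (intro equalityI subsetI)
    fix z assume "z \<in> pull W \<iota> ` ?A"
    then obtain x where x: "x \<in> ?A" "z = pull W \<iota> x" by blast
    have s: "{v. z v \<noteq> 0} \<in> T" "{w. x w \<noteq> 0} = \<iota> ` {v. z v \<noteq> 0}"
      using realization_image_support[OF inj sub x(1)] x(2) by auto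
    have sW: "{v. z v \<noteq> 0} \<subseteq> W" using x(2) by (auto simp: pull_def)
    have "(\<Sum>v | z v \<noteq> 0. z v) = (\<Sum>v | z v \<noteq> 0. x (\<iota> v))"
      using sW x(2) by (intro sum.cong) (auto simp: pull_def)
    also have "\<dots> = (\<Sum>w | x w \<noteq> 0. x w)"
      unfolding s(2) using sum.reindex[OF inj_on_subset[OF inj sW], of x] by simp
    also have "\<dots> = 1" using x(1) by (simp add: geometric_realization_def)
    finally show "z \<in> geometric_realization T"
      using s x by (auto simp: geometric_realization_def pull_def)
  next
    fix z assume z: "z \<in> geometric_realization T"
    then have sW: "{v. z v \<noteq> 0} \<subseteq> W" using sub by (auto simp: geometric_realization_def)
    define x where "x w = (if w \<in> \<iota> ` W then z (inv_into W \<iota> w) else 0)" for w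
    have xi: "v \<in> W \<Longrightarrow> x (\<iota> v) = z v" for v using inj by (simp add: x_def)
    have zx: "z = pull W \<iota> x"
    proof
      fix v show "z v = pull W \<iota> x v" using sW by (cases "v \<in> W") (auto simp: pull_def xi)
    qed
    have s: "{w. x w \<noteq> 0} = \<iota> ` {v. z v \<noteq> 0}"
      unfolding zx by (rule pull_support) (auto simp: x_def)
    have "(\<Sum>w | x w \<noteq> 0. x w) = (\<Sum>v | z v \<noteq> 0. x (\<iota> v))"
      unfolding s using sum.reindex[OF inj_on_subset[OF inj sW], of x] by simp
    also have "\<dots> = (\<Sum>v | z v \<noteq> 0. z v)" using sW by (intro sum.cong) (auto simp: xi)
    also have "\<dots> = 1" using z by (simp add: geometric_realization_def)
    finally have "x \<in> ?A" using z s by (auto simp: geometric_realization_def x_def)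
    then show "z \<in> pull W \<iota> ` ?A" using zx by blast
  qed
qed

definition boxnorm :: "real \<times> real \<Rightarrow> real" where "boxnorm p = max \<bar>fst p\<bar> \<bar>snd p\<bar>"

text \<open>The surface \<open>max \<bar>a\<bar> \<bar>b\<bar> + \<bar>c\<bar> = 1\<close> is a pillow: two copies of the square glued along their boundaries.\<close>

definition pillow :: "((real \<times> real) \<times> real) set" where
  "pillow = {(p, c). boxnorm p + \<bar>c\<bar> = 1}"

lemma boxnorm_nonneg: "0 \<le> boxnorm p" by (auto simp: boxnorm_def)

lemma boxnorm_scale: "boxnorm (r *\<^sub>R p) = \<bar>r\<bar> * boxnorm p"
  by (auto simp: boxnorm_def abs_mult max_mult_distrib_left)

lemma boxnorm_eq_0: "boxnorm p = 0 \<longleftrightarrow> p = 0"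
  by (auto simp: boxnorm_def prod_eq_iff max_def split: if_splits)

lemma continuous_boxnorm: "continuous_on S boxnorm"
  unfolding boxnorm_def by (intro continuous_intros)

text \<open>The pillow is the unit sphere of a norm, and rescaling along rays maps it onto the
  Euclidean unit sphere; both spaces have dimension three.\<close>

lemma pillow_homeomorphic_sphere: "pillow homeomorphic (sphere 0 1 :: (real ^ 3) set)"
proof -
  let ?N = "\<lambda>z :: (real \<times> real) \<times> real. boxnorm (fst z) + \<bar>snd z\<bar>"
  have N_scale: "?N (r *\<^sub>R z) = \<bar>r\<bar> * ?N z" for r z
    by (simp add: boxnorm_scale abs_mult algebra_simps)
  have N_pos: "?N z > 0" if "z \<noteq> 0" for z
  proof -
    have "?N z \<noteq> 0"
    proof
      assume "?N z = 0"
      then have "boxnorm (fst z) = 0" "snd z = 0" using boxnorm_nonneg[of "fst z"] by linarith+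
      then show False using that by (simp add: boxnorm_eq_0 prod_eq_iff)
    qed
    then show ?thesis using boxnorm_nonneg[of "fst z"] by linarith
  qed
  have ne: "z \<noteq> 0" if "z \<in> pillow" for z
  proof
    assume "z = 0"
    then have "z = ((0, 0), 0)" by (simp add: prod_eq_iff)
    then show False using that by (simp add: pillow_def boxnorm_def)
  qed
  have cN: "continuous_on S ?N" for S
    by (intro continuous_intros continuous_on_compose2[OF continuous_boxnorm[of UNIV]]) auto
  have "homeomorphism pillow (sphere 0 1) (\<lambda>z. z /\<^sub>R norm z) (\<lambda>z. z /\<^sub>R ?N z)"
  proof (rule homeomorphismI)
    show "continuous_on pillow (\<lambda>z. z /\<^sub>R norm z)" using ne by (intro continuous_intros) auto
    have "?N z \<noteq> 0" if "z \<in> sphere 0 1" for z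
    proof -
      have "z \<noteq> 0" using that by auto
      from N_pos[OF this] show ?thesis by simp
    qed
    then show "continuous_on (sphere 0 1) (\<lambda>z. z /\<^sub>R ?N z)"
      by (intro continuous_intros cN) blast
    show "(\<lambda>z. z /\<^sub>R norm z) ` pillow \<subseteq> sphere 0 1"
      using ne by (intro image_subsetI) (simp del: split_paired_All)
    show "(\<lambda>z. z /\<^sub>R ?N z) ` sphere 0 1 \<subseteq> pillow"
    proof (rule image_subsetI)
      fix z assume "z \<in> sphere (0 :: (real \<times> real) \<times> real) 1"
      then have "z \<noteq> 0" by auto
      from N_pos[OF this] have "?N (inverse (?N z) *\<^sub>R z) = 1"
        unfolding N_scale by simp
      then show "z /\<^sub>R ?N z \<in> pillow" by (simp add: pillow_def case_prod_beta)
    qed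

    show "z /\<^sub>R norm z /\<^sub>R ?N (z /\<^sub>R norm z) = z" if "z \<in> pillow" for z
    proof -
      have "?N z = 1" using that by (auto simp: pillow_def)
      then have "?N (z /\<^sub>R norm z) = inverse (norm z)" unfolding N_scale by simp
      then show ?thesis using ne[OF that] by simp
    qed
    show "z /\<^sub>R ?N z /\<^sub>R norm (z /\<^sub>R ?N z) = z" if "z \<in> sphere 0 1" for z
    proof -
      have z: "z \<noteq> 0" "norm z = 1" using that by auto
      then have "norm (z /\<^sub>R ?N z) = inverse (?N z)" using N_pos[OF z(1)] by simp
      then show ?thesis using N_pos[OF z(1)] by simp
    qed
  qed
  then have "pillow homeomorphic (sphere 0 1 :: ((real \<times> real) \<times> real) set)"
    unfolding homeomorphic_def by blast
  also have "(sphere 0 1 :: ((real \<times> real) \<times> real) set) homeomorphic (sphere 0 1 :: (real ^ 3) set)"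
    by (rule homeomorphic_spheres_gen) auto
  finally show ?thesis .
qed

text \<open>The sheets go to the halves of the pillow with third coordinate
  \<open>1 - boxnorm\<close> and its negative. \<open>seam\<close> makes the two formulas agree on
  the overlap, and \<open>boundary\<close> ensures that no point of the equator has two preimages. A
  continuous bijection from a compact space to a Hausdorff one is a homeomorphism.\<close>

lemma doubled_square_homeomorphic_sphere:
  fixes A B :: "'a::t2_space set" and f g :: "'a \<Rightarrow> real \<times> real"
  assumes comp: "compact A" "compact B"
    and cont: "continuous_on A f" "continuous_on B g"
    and bij: "bij_betw f A {p. boxnorm p \<le> 1}" "bij_betw g B {p. boxnorm p \<le> 1}"
    and seam: "\<And>x. x \<in> A \<Longrightarrow> x \<in> B \<Longrightarrow> f x = g x \<and> boxnorm (f x) = 1"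
    and boundary: "\<And>x. x \<in> A \<Longrightarrow> boxnorm (f x) = 1 \<Longrightarrow> x \<in> B"
  shows "(A \<union> B) homeomorphic (sphere 0 1 :: (real ^ 3) set)"
proof -
  define h where "h x = (if x \<in> A then (f x, 1 - boxnorm (f x)) else (g x, boxnorm (g x) - 1))" for x
  have hA: "x \<in> A \<Longrightarrow> h x = (f x, 1 - boxnorm (f x))" for x by (simp add: h_def)
  have hB: "x \<in> B \<Longrightarrow> h x = (g x, boxnorm (g x) - 1)" for x
    using seam[of x] by (cases "x \<in> A") (auto simp: h_def)
  have fA: "boxnorm (f x) \<le> 1" if "x \<in> A" for x using bij_betwE[OF bij(1)] that by auto
  have gB: "boxnorm (g x) \<le> 1" if "x \<in> B" for x using bij_betwE[OF bij(2)] that by auto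
  have "continuous_on (A \<union> B) h"
  proof (rule continuous_on_closed_Un)
    show "closed A" "closed B" using comp by (auto intro: compact_imp_closed)
    have "continuous_on A (\<lambda>x. (f x, 1 - boxnorm (f x)))"
      using cont by (intro continuous_intros continuous_on_compose2[OF continuous_boxnorm[of UNIV]]) auto
    then show "continuous_on A h" by (rule continuous_on_eq) (simp add: hA)
    have "continuous_on B (\<lambda>x. (g x, boxnorm (g x) - 1))"
      using cont by (intro continuous_intros continuous_on_compose2[OF continuous_boxnorm[of UNIV]]) auto
    then show "continuous_on B h" by (rule continuous_on_eq) (simp add: hB)
  qed
  moreover have "h ` (A \<union> B) = pillow"
  proof (intro equalityI subsetI)
    fix z assume "z \<in> h ` (A \<union> B)"
    then show "z \<in> pillow" using fA gB by (auto simp: hA hB pillow_def)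
  next
    fix z assume z: "z \<in> pillow"
    obtain p c where pc: "z = (p, c)" by (cases z)
    with z have N: "boxnorm p + \<bar>c\<bar> = 1" by (simp add: pillow_def)
    then have p: "p \<in> {p. boxnorm p \<le> 1}" by simp
    show "z \<in> h ` (A \<union> B)"
    proof (cases "c \<ge> 0")
      case True
      obtain x where "x \<in> A" "f x = p" using p bij(1) by (metis bij_betw_imp_surj_on imageE)
      then show ?thesis using True N pc hA[of x] by (intro image_eqI[of _ _ x]) auto
    next
      case False
      obtain x where "x \<in> B" "g x = p" using p bij(2) by (metis bij_betw_imp_surj_on imageE)
      then show ?thesis using False N pc hB[of x] by (intro image_eqI[of _ _ x]) auto
    qed
  qed
  moreover have "inj_on h (A \<union> B)"
  proof -
    have cross: "x = y" if "x \<in> A" "y \<in> B" "h x = h y" for x y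
    proof -
      have e: "f x = g y" "boxnorm (f x) = 1" using that fA[of x] gB[of y] by (auto simp: hA hB)
      then have "x \<in> B" using boundary that by blast
      then have "g x = g y" using seam that e by auto
      then show ?thesis using \<open>x \<in> B\<close> that(2) bij(2) by (meson bij_betw_imp_inj_on inj_onD)
    qed
    have "x = y" if "x \<in> A" "y \<in> A" "h x = h y" for x y
      using that bij(1) by (auto simp: hA bij_betw_def inj_on_def)
    moreover have "x = y" if "x \<in> B" "y \<in> B" "h x = h y" for x y
      using that bij(2) by (auto simp: hB bij_betw_def inj_on_def)
    ultimately show ?thesis using cross unfolding inj_on_def by (metis UnE)
  qed
  ultimately have "(A \<union> B) homeomorphic pillow"
    using comp by (intro homeomorphic_compact[of _ h]) auto
  then show ?thesis using pillow_homeomorphic_sphere homeomorphic_trans by blast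
qed

section \<open>The triangulated strip\<close>

locale strip =
  fixes m :: nat
  assumes m_pos: "0 < m"
begin

text \<open>The strip has vertices \<open>(j, i)\<close> with \<open>j \<le> J\<close> and \<open>i < n j\<close>. The slab between the levels
  \<open>j\<close> and \<open>j + 1\<close> is triangulated by a staircase: the \<open>k\<close>-th rung \<open>E j k\<close> joins the \<open>l j k\<close>-th
  lower vertex to the \<open>u j k\<close>-th upper one, and from one rung to the next exactly one of the two ends advances.
  \<open>J\<close> is chosen so that no doubling slab touches either end, and \<open>L\<close> so that \<open>(n J)\<^sup>2\<close> is
  comparable to \<open>L\<close>.\<close>

definition L :: nat where "L = 4 ^ m"
definition J :: nat where "J = m * L - 1"
definition n :: "nat \<Rightarrow> nat" where "n j = 4 * 2 ^ (j div L)"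
definition dbl :: "nat \<Rightarrow> bool" where "dbl j \<longleftrightarrow> L dvd Suc j"
text \<open>On a plain slab the ends advance alternately, the upper one first. On a doubling slab
  the pattern is upper, lower, upper, so the upper end moves twice as often.\<close>

definition l :: "nat \<Rightarrow> nat \<Rightarrow> nat" where "l j k = (if dbl j then Suc k div 3 else k div 2)"
definition u :: "nat \<Rightarrow> nat \<Rightarrow> nat" where "u j k = k - l j k"
definition len :: "nat \<Rightarrow> nat" where "len j = n j + n (Suc j) - 2"
definition E :: "nat \<Rightarrow> nat \<Rightarrow> (nat \<times> nat) set" where "E j k = {(j, l j k), (Suc j, u j k)}"
definition T :: "(nat \<times> nat) set set" where
  "T = {\<sigma>. \<sigma> \<noteq> {} \<and> (\<exists>j k. j < J \<and> k < len j \<and> \<sigma> \<subseteq> E j k \<union> E j (Suc k))}"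
definition W :: "(nat \<times> nat) set" where "W = {(j, i). j \<le> J \<and> i < n j}"

lemma L_ge4: "L \<ge> 4"
proof -
  have "(4::nat) ^ 1 \<le> 4 ^ m" using m_pos by (intro power_increasing) auto
  then show ?thesis by (simp add: L_def)
qed

lemma Suc_J: "Suc J = m * L"
  using L_ge4 m_pos by (simp add: J_def)

lemma J_ge3: "J \<ge> 3"
proof -
  have "1 * 4 \<le> m * L" using m_pos L_ge4 by (intro mult_le_mono) auto
  then show ?thesis by (simp add: J_def)
qed

lemma n_ge4: "n j \<ge> 4"
  by (simp add: n_def)

lemma n_Suc: "n (Suc j) = (if dbl j then 2 * n j else n j)"
  using L_ge4 by (auto simp: n_def dbl_def div_Suc dvd_eq_mod_eq_0)

text \<open>\<open>J\<close> and \<open>Suc J\<close> cannot both be multiples of \<open>L\<close>.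
  A plain last slab is what the treatment of the corner diagonal at the top requires.\<close>

lemma not_dbl_last: "Suc j = J \<Longrightarrow> \<not> dbl j"
proof
  assume j: "Suc j = J" and d: "dbl j"
  from d have "L dvd J" by (simp add: dbl_def j)
  moreover have "L dvd Suc J" by (simp add: Suc_J)
  ultimately have "L dvd 1" by (metis Suc_eq_plus1 dvd_add_right_iff)
  then show False using L_ge4 by simp
qed

lemma l_le: "l j k \<le> k"
  by (auto simp: l_def)

lemma lu_sum: "l j k + u j k = k"
  using l_le[of j k] by (simp add: u_def)

lemma lu_0: "l j 0 = 0" "u j 0 = 0"
  by (auto simp: l_def u_def)

lemma lu_step: "l j (Suc k) = l j k \<and> u j (Suc k) = Suc (u j k) \<or> l j (Suc k) = Suc (l j k) \<and> u j (Suc k) = u j k"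
proof -
  have "l j (Suc k) = l j k \<or> l j (Suc k) = Suc (l j k)"
    by (cases "dbl j"; simp add: l_def; presburger)
  then show ?thesis using lu_sum[of j k] lu_sum[of j "Suc k"] by linarith
qed

lemma l_mono: "k \<le> k' \<Longrightarrow> l j k \<le> l j k'"
  by (rule lift_Suc_mono_le[of "l j"]) (metis lu_step le_SucI order_refl)

lemma u_mono: "k \<le> k' \<Longrightarrow> u j k \<le> u j k'"
  by (rule lift_Suc_mono_le[of "u j"]) (metis lu_step le_SucI order_refl)

lemma l_len: "l j (len j) = n j - 1"
  using n_ge4[of j] by (auto simp: l_def len_def n_Suc)

lemma u_len: "u j (len j) = n (Suc j) - 1"
  using lu_sum[of j "len j", unfolded l_len] n_ge4[of j] n_ge4[of "Suc j"] len_def[of j] by linarith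

lemma l_less: "k \<le> len j \<Longrightarrow> l j k < n j" and u_less: "k \<le> len j \<Longrightarrow> u j k < n (Suc j)"
  using l_mono[of k "len j" j] u_mono[of k "len j" j] n_ge4[of j] n_ge4[of "Suc j"]
  unfolding l_len u_len by linarith+

lemma len_ge: "len j \<ge> 6"
  using n_ge4[of j] n_ge4[of "Suc j"] by (simp add: len_def)

text \<open>The witness is the rung just before the lower end leaves \<open>i\<close>. This puts
  every edge of the lower row into a triangle of the slab.\<close>

lemma l_step_exists:
  assumes "Suc i < n j"
  shows "\<exists>k<len j. l j k = i \<and> l j (Suc k) = Suc i"
proof (cases "dbl j")
  case True
  then show ?thesis using assms by (intro exI[of _ "3 * i + 1"]) (auto simp: l_def len_def n_Suc)
next
  case False
  then show ?thesis using assms by (intro exI[of _ "2 * i + 1"]) (auto simp: l_def len_def n_Suc)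
qed

lemma u_step_exists:
  assumes "Suc i < n (Suc j)"
  shows "\<exists>k<len j. u j k = i \<and> u j (Suc k) = Suc i"
proof (cases "dbl j")
  case True
  show ?thesis
  proof (cases "even i")
    case even: True
    then obtain a where a: "i = 2 * a" by blast
    then show ?thesis using True assms by (intro exI[of _ "3 * a"]) (auto simp: l_def u_def len_def n_Suc)
  next
    case odd: False
    then obtain a where a: "i = Suc (2 * a)" by (auto elim: oddE)
    have "Suc (Suc (3 * a + 2)) div 3 = Suc a" by simp
    then show ?thesis using True assms a by (intro exI[of _ "3 * a + 2"]) (auto simp: l_def u_def len_def n_Suc)
  qed
next
  case False
  then show ?thesis using assms by (intro exI[of _ "2 * i"]) (auto simp: l_def u_def len_def n_Suc)
qed

lemma E_sub_W: "j < J \<Longrightarrow> k \<le> len j \<Longrightarrow> E j k \<subseteq> W"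
  using l_less u_less by (auto simp: E_def W_def)

lemma finite_W: "finite W"
proof -
  have "W = Sigma {..J} (\<lambda>j. {..<n j})" by (auto simp: W_def)
  then show ?thesis by simp
qed

lemma T_sub_W: "\<sigma> \<in> T \<Longrightarrow> \<sigma> \<subseteq> W"
  unfolding T_def using E_sub_W[OF _ less_imp_le] E_sub_W[OF _ Suc_leI] by blast

lemma finite_T: "finite T"
  by (rule finite_subset[of _ "Pow W"]) (use T_sub_W finite_W in auto)

lemma T_down: "\<sigma> \<in> T \<Longrightarrow> \<tau> \<subseteq> \<sigma> \<Longrightarrow> \<tau> \<noteq> {} \<Longrightarrow> \<tau> \<in> T"
  unfolding T_def by blast

lemma T_I: "j < J \<Longrightarrow> k < len j \<Longrightarrow> \<sigma> \<noteq> {} \<Longrightarrow> \<sigma> \<subseteq> E j k \<union> E j (Suc k) \<Longrightarrow> \<sigma> \<in> T"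
  unfolding T_def by blast

lemma T_E: 
  assumes "\<sigma> \<in> T"
  obtains j k where "j < J" "k < len j" "\<sigma> \<noteq> {}" "\<sigma> \<subseteq> E j k \<union> E j (Suc k)"
  using assms unfolding T_def by blast

lemma E_in_T:
  assumes "j < J" "k \<le> len j" "\<sigma> \<noteq> {}" "\<sigma> \<subseteq> E j k"
  shows "\<sigma> \<in> T"
proof (cases "k < len j")
  case True
  then show ?thesis using assms by (intro T_I[of j k]) auto
next
  case False
  \<comment> \<open>The last rung bounds a triangle on its left only.\<close>
  then show ?thesis using assms len_ge[of j] by (intro T_I[of j "k - 1"]) auto
qed

lemma horizontal_in_T:
  assumes "j \<le> J" "Suc i < n j" "\<sigma> \<noteq> {}" "\<sigma> \<subseteq> {(j, i), (j, Suc i)}"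
  shows "\<sigma> \<in> T"
proof (cases "j < J")
  case True
  obtain k where k: "k < len j" "l j k = i" "l j (Suc k) = Suc i"
    using l_step_exists[OF assms(2)] by auto
  have "\<sigma> \<subseteq> E j k \<union> E j (Suc k)" using assms(4) k unfolding E_def by auto
  then show ?thesis using assms(3) True k(1) by (intro T_I[of j k])
next
  case False
  \<comment> \<open>Above level \<open>J\<close> there is no slab, so the edge is found in the upper
    row of the slab below.\<close>
  then obtain j' where j': "j = Suc j'" "j' < J" using assms(1) J_ge3 by (cases j) auto
  obtain k where k: "k < len j'" "u j' k = i" "u j' (Suc k) = Suc i"
    using u_step_exists[of i j'] assms(2) j' by auto
  have "\<sigma> \<subseteq> E j' k \<union> E j' (Suc k)" using assms(4) k j' unfolding E_def by auto
  then show ?thesis using assms(3) j' k(1) by (intro T_I[of j' k])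
qed

lemma singleton_in_T: "v \<in> W \<Longrightarrow> {v} \<in> T"
proof -
  assume "v \<in> W"
  then obtain j i where v: "v = (j, i)" "j \<le> J" "i < n j" by (auto simp: W_def)
  show ?thesis
  proof (cases "Suc i < n j")
    case True
    then show ?thesis using v by (intro horizontal_in_T[of j i]) auto
  next
    case False
    then show ?thesis using v n_ge4[of j] by (intro horizontal_in_T[of j "i - 1"]) auto
  qed
qed

lemma Union_T: "\<Union>T = W"
  using T_sub_W singleton_in_T by blast

lemma T_edge_same:
  assumes "\<sigma> \<in> T" "(j, i) \<in> \<sigma>" "(j, i') \<in> \<sigma>"
  shows "i' \<le> Suc i"
  using assms(1)
proof (rule T_E)
  fix j0 k assume "\<sigma> \<subseteq> E j0 k \<union> E j0 (Suc k)"
  with assms(2,3) have "(j, i) \<in> E j0 k \<union> E j0 (Suc k)" "(j, i') \<in> E j0 k \<union> E j0 (Suc k)" by auto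
  then show ?thesis using lu_step[of j0 k] by (auto simp: E_def)
qed

lemma T_edge_level:
  assumes "\<sigma> \<in> T" "(j, i) \<in> \<sigma>" "(j', i') \<in> \<sigma>"
  shows "j' \<le> Suc j"
  using assms(1)
proof (rule T_E)
  fix j0 k assume "\<sigma> \<subseteq> E j0 k \<union> E j0 (Suc k)"
  with assms(2,3) have "(j, i) \<in> E j0 k \<union> E j0 (Suc k)" "(j', i') \<in> E j0 k \<union> E j0 (Suc k)" by auto
  then show ?thesis by (auto simp: E_def)
qed

text \<open>The bounds are asymmetric: the diagonals of plain slabs all lean the same way. This lean
  degree-bounds the graph and, later, excludes mirrored corner diagonals.\<close>

lemma T_edge_vertical:
  assumes "\<sigma> \<in> T" "(j, i) \<in> \<sigma>" "(Suc j, i') \<in> \<sigma>"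
  shows "if dbl j then 2 * i \<le> Suc i' \<and> i' \<le> Suc (2 * i) else i \<le> i' \<and> i' \<le> Suc i"
  using assms(1)
proof (rule T_E)
  fix j0 k assume "\<sigma> \<subseteq> E j0 k \<union> E j0 (Suc k)"
  with assms(2,3) have "(j, i) \<in> E j0 k \<union> E j0 (Suc k)" "(Suc j, i') \<in> E j0 k \<union> E j0 (Suc k)" by blast+
  then have *: "(i, i') \<in> {l j k, l j (Suc k)} \<times> {u j k, u j (Suc k)}" by (auto simp: E_def)
  show ?thesis
  proof (cases "dbl j")
    case True
    define q r where "q = (k+1) div 3" and "r = (k+2) div 3"
    have "i = q \<or> i = r" "i' = k - q \<or> i' = k + 1 - r"
      using * True by (auto simp: l_def u_def q_def r_def)
    moreover have "3 * q \<le> k + 1" "k + 1 \<le> 3 * q + 2" "3 * r \<le> k + 2" "k + 2 \<le> 3 * r + 2"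
      unfolding q_def r_def by presburger+
    ultimately have "2 * i \<le> Suc i' \<and> i' \<le> Suc (2 * i)" by linarith
    then show ?thesis using True by simp
  next
    case False
    define q r where "q = k div 2" and "r = (k+1) div 2"
    have "i = q \<or> i = r" "i' = k - q \<or> i' = k + 1 - r"
      using * False by (auto simp: l_def u_def q_def r_def)
    moreover have "2 * q \<le> k" "k \<le> 2 * q + 1" "2 * r \<le> k + 1" "k + 1 \<le> 2 * r + 1"
      unfolding q_def r_def by presburger+
    ultimately have "i \<le> i' \<and> i' \<le> Suc i" by linarith
    then show ?thesis using False by simp
  qed
qed

lemma T_vertical_straight:
  assumes "\<not> dbl j" "j < J" "i < n j"
  shows "{(j, i), (Suc j, i)} \<in> T"
  by (rule E_in_T[of j "2 * i"]) (use assms in \<open>auto simp: E_def l_def u_def len_def n_Suc\<close>)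

lemma T_vertical_double:
  assumes "dbl j" "j < J" "i < n j"
  shows "{(j, i), (Suc j, 2 * i)} \<in> T" "{(j, i), (Suc j, Suc (2 * i))} \<in> T"
proof -
  have l: "l j (3 * i) = i" "l j (3 * i + 1) = i" using assms(1) unfolding l_def by (simp, presburger)
  then have u: "u j (3 * i) = 2 * i" "u j (3 * i + 1) = Suc (2 * i)"
    using lu_sum[of j "3 * i"] lu_sum[of j "3 * i + 1"] by linarith+
  have le: "3 * i + 1 \<le> len j" using assms by (auto simp: len_def n_Suc)
  show "{(j, i), (Suc j, 2 * i)} \<in> T"
    by (rule E_in_T[of j "3 * i"]) (use assms(2) l u le in \<open>auto simp: E_def\<close>)
  show "{(j, i), (Suc j, Suc (2 * i))} \<in> T"
    by (rule E_in_T[of j "3 * i + 1"]) (use assms(2) l u le in \<open>auto simp: E_def\<close>)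
qed

text \<open>Two consecutive rungs share one end and span three distinct vertices, so one of them
  differs from both ends of the edge.\<close>

lemma T_edge_in_triangle:
  assumes "{v, w} \<in> T" "v \<noteq> w"
  shows "\<exists>z. z \<noteq> v \<and> z \<noteq> w \<and> {v, w, z} \<in> T"
  using assms(1)
proof (rule T_E)
  fix j k assume jk: "j < J" "k < len j" and sub: "{v, w} \<subseteq> E j k \<union> E j (Suc k)"
  have "\<exists>z \<in> E j k \<union> E j (Suc k). z \<noteq> v \<and> z \<noteq> w"
  proof (rule ccontr)
    assume "\<not> ?thesis"
    then have "E j k \<union> E j (Suc k) \<subseteq> {v, w}" by blast
    then have "{(j, l j k), (Suc j, u j k), (j, l j (Suc k)), (Suc j, u j (Suc k))} \<subseteq> {v, w}"
      by (simp add: E_def)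
    then show False using lu_step[of j k] by auto
  qed
  then obtain z where "z \<in> E j k \<union> E j (Suc k)" "z \<noteq> v" "z \<noteq> w" by blast
  then show ?thesis using jk sub by (intro exI[of _ z] conjI T_I[of j k]) auto
qed

end

section \<open>Level and relative position as coordinates on the realization of the strip\<close>

context strip begin

definition pos :: "nat \<times> nat \<Rightarrow> real" where "pos v = real (snd v) / (real (n (fst v)) - 1)"
definition edge_pt :: "nat \<Rightarrow> real \<Rightarrow> nat \<Rightarrow> nat \<times> nat \<Rightarrow> real" where
  "edge_pt j s k v = (if v = (j, l j k) then 1 - s else if v = (Suc j, u j k) then s else 0)"
text \<open>At fixed height \<open>s\<close> a slab is crossed by a line that meets the rungs in
  order: \<open>k\<close> selects the triangle, and \<open>r\<close> the place between its two
  rungs.\<close>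

definition seg_pt :: "nat \<Rightarrow> real \<Rightarrow> nat \<Rightarrow> real \<Rightarrow> nat \<times> nat \<Rightarrow> real" where
  "seg_pt j s k r v = (1 - r) * edge_pt j s k v + r * edge_pt j s (Suc k) v"
definition edge_pos :: "nat \<Rightarrow> real \<Rightarrow> nat \<Rightarrow> real" where
  "edge_pos j s k = (1 - s) * pos (j, l j k) + s * pos (Suc j, u j k)"
definition rep :: "nat \<Rightarrow> real \<Rightarrow> (nat \<times> nat \<Rightarrow> real) \<Rightarrow> bool" where
  "rep j s x \<longleftrightarrow> (\<exists>k<len j. \<exists>r. 0 \<le> r \<and> r \<le> 1 \<and> x = seg_pt j s k r)"

lemma n1_pos: "real (n j) - 1 > 0" using n_ge4[of j] by linarith

lemma bary_edge_pt:
  assumes "j < J" "k \<le> len j"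
  shows "bary_sum W g (edge_pt j s k) = (1 - s) * g (j, l j k) + s * g (Suc j, u j k)"
proof -
  have "bary_sum W g (edge_pt j s k) = (\<Sum>v\<in>E j k. edge_pt j s k v * g v)"
    unfolding bary_sum_def
    by (rule sum.mono_neutral_right) (use E_sub_W[OF assms] finite_W in \<open>auto simp: edge_pt_def E_def\<close>)
  then show ?thesis by (simp add: E_def edge_pt_def)
qed

lemma bary_seg_pt:
  assumes "j < J" "k < len j"
  shows "bary_sum W g (seg_pt j s k r) = (1 - r) * ((1 - s) * g (j, l j k) + s * g (Suc j, u j k))
    + r * ((1 - s) * g (j, l j (Suc k)) + s * g (Suc j, u j (Suc k)))"
proof -
  have "bary_sum W g (seg_pt j s k r) = (1 - r) * bary_sum W g (edge_pt j s k) + r * bary_sum W g (edge_pt j s (Suc k))"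
    by (simp add: bary_sum_def seg_pt_def distrib_right sum.distrib sum_distrib_left mult.assoc)
  then show ?thesis using assms by (simp add: bary_edge_pt)
qed

text \<open>In a triangle, \<open>s\<close> is the total weight on the upper level, and
  \<open>r\<close> is the share of the newly reached vertex in the weight of its own level.\<close>

lemma realization_rep:
  assumes x: "x \<in> geometric_realization T"
  shows "\<exists>j<J. \<exists>s. 0 \<le> s \<and> s \<le> 1 \<and> rep j s x"
proof -
  have nn: "\<And>v. 0 \<le> x v" and sT: "{v. x v \<noteq> 0} \<in> T" using x by (auto simp: geometric_realization_def)
  obtain j k where jk: "j < J" "k < len j" "{v. x v \<noteq> 0} \<subseteq> E j k \<union> E j (Suc k)"
    using sT by (rule T_E)
  have sum1: "(\<Sum>v\<in>S. x v) = 1" if "finite S" "{v. x v \<noteq> 0} \<subseteq> S" for S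
  proof -
    have "(\<Sum>v\<in>{v. x v \<noteq> 0}. x v) = (\<Sum>v\<in>S. x v)" using that by (intro sum.mono_neutral_left) auto
    then show ?thesis using x by (simp add: geometric_realization_def)
  qed
  define a b where "a = l j k" and "b = u j k"
  consider "l j (Suc k) = a" "u j (Suc k) = Suc b" | "l j (Suc k) = Suc a" "u j (Suc k) = b"
    using lu_step[of j k] by (auto simp: a_def b_def)
  then show ?thesis
  proof cases
    case 1
    then have "{v. x v \<noteq> 0} \<subseteq> {(j, a), (Suc j, b), (Suc j, Suc b)}"
      using jk(3) by (auto simp: E_def a_def b_def)
    then have zero: "v \<notin> {(j, a), (Suc j, b), (Suc j, Suc b)} \<Longrightarrow> x v = 0" for v by blast
    have sum: "x (j, a) + x (Suc j, b) + x (Suc j, Suc b) = 1"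
      using sum1[of "{(j, a), (Suc j, b), (Suc j, Suc b)}"] zero by fastforce
    \<comment> \<open>If the upper level carries no weight, both rung points coincide and any
      \<open>r\<close> represents \<open>x\<close>; 0 is taken. The other case does the same for the
      lower level.\<close>
    define s r where "s = x (Suc j, b) + x (Suc j, Suc b)"
      and "r = (if s = 0 then 0 else x (Suc j, Suc b) / s)"
    have s: "0 \<le> s" "s \<le> 1" using sum nn[of "(j, a)"] nn[of "(Suc j, b)"] nn[of "(Suc j, Suc b)"]
      by (simp_all add: s_def)
    have r: "0 \<le> r" "r \<le> 1" using s nn[of "(Suc j, b)"] nn[of "(Suc j, Suc b)"]
      by (auto simp: r_def s_def field_simps)
    have rs: "r * s = x (Suc j, Suc b)" using nn[of "(Suc j, b)"] nn[of "(Suc j, Suc b)"]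
      by (auto simp: r_def s_def)
    then have rs': "(1 - r) * s = x (Suc j, b)" by (simp add: s_def algebra_simps)
    have "x = seg_pt j s k r"
    proof
      fix v
      consider "v = (j, a)" | "v = (Suc j, b)" | "v = (Suc j, Suc b)"
        | "v \<notin> {(j, a), (Suc j, b), (Suc j, Suc b)}" by blast
      then show "x v = seg_pt j s k r v"
      proof cases
        case 1
        with \<open>l j (Suc k) = a\<close> have "seg_pt j s k r v = 1 - s"
          by (simp add: seg_pt_def edge_pt_def a_def[symmetric]) (simp add: algebra_simps)
        with 1 sum show ?thesis by (simp add: s_def)
      qed (use \<open>l j (Suc k) = a\<close> \<open>u j (Suc k) = Suc b\<close> rs rs' zero in
          \<open>simp_all add: seg_pt_def edge_pt_def a_def[symmetric] b_def[symmetric]\<close>)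
    qed
    then show ?thesis using jk s r unfolding rep_def by blast
  next
    case 2
    then have "{v. x v \<noteq> 0} \<subseteq> {(j, a), (j, Suc a), (Suc j, b)}"
      using jk(3) by (auto simp: E_def a_def b_def)
    then have zero: "v \<notin> {(j, a), (j, Suc a), (Suc j, b)} \<Longrightarrow> x v = 0" for v by blast
    have sum: "x (j, a) + x (j, Suc a) + x (Suc j, b) = 1"
      using sum1[of "{(j, a), (j, Suc a), (Suc j, b)}"] zero by fastforce
    define s r where "s = x (Suc j, b)"
      and "r = (if s = 1 then 0 else x (j, Suc a) / (1 - s))"
    have s1: "1 - s = x (j, a) + x (j, Suc a)" using sum by (simp add: s_def)
    have s: "0 \<le> s" "s \<le> 1" using s1 nn[of "(j, a)"] nn[of "(j, Suc a)"] nn[of "(Suc j, b)"]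
      by (simp_all add: s_def)
    have r: "0 \<le> r" "r \<le> 1" using s s1 nn[of "(j, a)"] nn[of "(j, Suc a)"]
      by (auto simp: r_def field_simps)
    have rs: "r * (1 - s) = x (j, Suc a)"
      using s1 nn[of "(j, a)"] nn[of "(j, Suc a)"] by (cases "s = 1") (simp_all add: r_def)
    have "(1 - r) * (1 - s) = (1 - s) - r * (1 - s)" by (simp add: algebra_simps)
    then have rs': "(1 - r) * (1 - s) = x (j, a)" using rs s1 by linarith
    have "x = seg_pt j s k r"
    proof
      fix v
      consider "v = (j, a)" | "v = (j, Suc a)" | "v = (Suc j, b)"
        | "v \<notin> {(j, a), (j, Suc a), (Suc j, b)}" by blast
      then show "x v = seg_pt j s k r v"
      proof cases
        case 3
        with \<open>u j (Suc k) = b\<close> have "seg_pt j s k r v = s"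
          by (simp add: seg_pt_def edge_pt_def b_def[symmetric]) (simp add: algebra_simps)
        with 3 show ?thesis by (simp add: s_def)
      qed (use \<open>l j (Suc k) = Suc a\<close> \<open>u j (Suc k) = b\<close> rs rs' zero in
          \<open>simp_all add: seg_pt_def edge_pt_def a_def[symmetric] b_def[symmetric]\<close>)
    qed
    then show ?thesis using jk s r unfolding rep_def by blast
  qed
qed

lemma rep_realization:
  assumes "j < J" "0 \<le> s" "s \<le> 1" "rep j s x"
  shows "x \<in> geometric_realization T"
proof -
  obtain k r where k: "k < len j" and r: "0 \<le> r" "r \<le> 1" and x: "x = seg_pt j s k r"
    using assms(4) unfolding rep_def by blast
  have sub: "{v. x v \<noteq> 0} \<subseteq> E j k \<union> E j (Suc k)" by (auto simp: x seg_pt_def edge_pt_def E_def split: if_splits)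
  have sum: "(\<Sum>v\<in>W. x v) = 1"
    using bary_seg_pt[OF assms(1) k, of "\<lambda>_. 1" s r] by (simp add: bary_sum_def x)
  have "{v. x v \<noteq> 0} \<noteq> {}"
  proof
    assume "{v. x v \<noteq> 0} = {}"
    then have "\<And>v. x v = 0" by blast
    then show False using sum by simp
  qed
  then have T: "{v. x v \<noteq> 0} \<in> T" using sub assms(1) k by (intro T_I[of j k])
  have "0 \<le> x v" for v using r assms(2,3) by (auto simp: x seg_pt_def edge_pt_def)
  then show ?thesis using T T_sub_W[OF T] finite_W sum by (intro realization_I[of W "{v. x v \<noteq> 0}"]) simp_all
qed

text \<open>Passing to the next rung shifts the position by the spacing of the advancing row times
  the weight of that row. The shift vanishes only if that weight is 0, and then the two rung points
  are equal.\<close>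

lemma edge_pos_step: 
  assumes "0 \<le> s" "s \<le> 1"
  shows "edge_pos j s k \<le> edge_pos j s (Suc k)" "edge_pos j s k = edge_pos j s (Suc k) \<Longrightarrow> edge_pt j s k = edge_pt j s (Suc k)"
proof -
  define a b where "a = 1 / (real (n j) - 1)" and "b = 1 / (real (n (Suc j)) - 1)"
  have ab: "a > 0" "b > 0" using n1_pos by (auto simp: a_def b_def)
  have edge_pos: "edge_pos j s k = (1 - s) * (real (l j k) * a) + s * (real (u j k) * b)" for k
    by (simp add: edge_pos_def pos_def a_def b_def)
  have step: "edge_pos j s (Suc k) = edge_pos j s k + s * b \<and> l j (Suc k) = l j k \<or>
     edge_pos j s (Suc k) = edge_pos j s k + (1 - s) * a \<and> u j (Suc k) = u j k"
    using lu_step[of j k] unfolding edge_pos by (auto simp: algebra_simps add_divide_distrib)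
  then show "edge_pos j s k \<le> edge_pos j s (Suc k)" using assms ab by auto
  assume "edge_pos j s k = edge_pos j s (Suc k)"
  with step ab have "s = 0 \<and> l j (Suc k) = l j k \<or> s = 1 \<and> u j (Suc k) = u j k" by auto
  then show "edge_pt j s k = edge_pt j s (Suc k)" by (auto simp: edge_pt_def fun_eq_iff)
qed

lemma edge_pos_mono: "0 \<le> s \<Longrightarrow> s \<le> 1 \<Longrightarrow> k \<le> k' \<Longrightarrow> edge_pos j s k \<le> edge_pos j s k'"
  using lift_Suc_mono_le[of "edge_pos j s"] edge_pos_step(1) by blast

lemma edge_pos_eq_edge_pt_eq:
  assumes "0 \<le> s" "s \<le> 1" "k \<le> k'" "edge_pos j s k = edge_pos j s k'"
  shows "edge_pt j s k = edge_pt j s k'"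
  using assms(3,4)
proof (induction k' rule: dec_induct)
  case (step i)
  have "edge_pos j s k \<le> edge_pos j s i" "edge_pos j s i \<le> edge_pos j s (Suc i)"
    using edge_pos_mono[OF assms(1,2) step.hyps(1)] edge_pos_step(1)[OF assms(1,2)] by auto
  then have eq: "edge_pos j s k = edge_pos j s i" "edge_pos j s i = edge_pos j s (Suc i)" using step.prems by auto
  then show ?case using step.IH edge_pos_step(2)[OF assms(1,2)] by metis
qed simp

lemma bary_pos_seg_pt:
  assumes "j < J" "k < len j"
  shows "bary_sum W pos (seg_pt j s k r) = (1 - r) * edge_pos j s k + r * edge_pos j s (Suc k)"
  using bary_seg_pt[OF assms, of pos] by (simp add: edge_pos_def)

lemma bary_level_seg_pt:
  assumes "j < J" "k < len j"
  shows "bary_sum W (\<lambda>v. real (fst v)) (seg_pt j s k r) = real j + s"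
  using bary_seg_pt[OF assms, of "\<lambda>v. real (fst v)"] by (simp add: algebra_simps)

text \<open>Along a line of fixed height the position never decreases and stagnates only where the
  points themselves coincide. Equal positions in different triangles therefore collapse everything
  in between.\<close>

lemma rep_inj:
  assumes j: "j < J" and s: "0 \<le> s" "s \<le> 1" and x: "rep j s x" and x': "rep j s x'"
    and eq: "bary_sum W pos x = bary_sum W pos x'"
  shows "x = x'"
proof -
  have main: "seg_pt j s k r = seg_pt j s k' r'"
    if k: "k < len j" "k' < len j" "k \<le> k'" and r: "0 \<le> r" "r \<le> 1" "0 \<le> r'" "r' \<le> 1"
      and eq: "(1 - r) * edge_pos j s k + r * edge_pos j s (Suc k) = (1 - r') * edge_pos j s k' + r' * edge_pos j s (Suc k')"
    for k k' r r'
  proof (cases "k = k'")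
    case True
    then have "(r - r') * (edge_pos j s (Suc k) - edge_pos j s k) = 0" using eq by (simp add: algebra_simps)
    then consider "r = r'" | "edge_pos j s k = edge_pos j s (Suc k)" by auto
    then show ?thesis
    proof cases
      case 2
      then have "edge_pt j s k = edge_pt j s (Suc k)" using edge_pos_step(2)[OF s] by blast
      then show ?thesis using True by (simp add: seg_pt_def algebra_simps fun_eq_iff)
    qed (use True in simp)
  next
    case False
    then have lt: "Suc k \<le> k'" using k by simp
    \<comment> \<open>The distance from the first point to the second splits into three nonnegative
      increments whose sum is zero.\<close>
    have "0 \<le> (1 - r) * (edge_pos j s (Suc k) - edge_pos j s k)" "0 \<le> r' * (edge_pos j s (Suc k') - edge_pos j s k')"
      using r edge_pos_step(1)[OF s] by (simp_all add: mult_nonneg_nonneg)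
    moreover have "edge_pos j s (Suc k) \<le> edge_pos j s k'" using edge_pos_mono[OF s lt] .
    moreover have "edge_pos j s (Suc k) - (1 - r) * (edge_pos j s (Suc k) - edge_pos j s k) = edge_pos j s k' + r' * (edge_pos j s (Suc k') - edge_pos j s k')"
      using eq by (simp add: algebra_simps)
    ultimately have 1: "edge_pos j s (Suc k) = edge_pos j s k'"
      and 2: "(1 - r) * (edge_pos j s (Suc k) - edge_pos j s k) = 0" and 3: "r' * (edge_pos j s (Suc k') - edge_pos j s k') = 0"
      by linarith+
    have "seg_pt j s k r = edge_pt j s (Suc k)"
    proof (cases "r = 1")
      case False
      then have "edge_pt j s k = edge_pt j s (Suc k)" using 2 edge_pos_step(2)[OF s] by auto
      then show ?thesis by (simp add: seg_pt_def algebra_simps fun_eq_iff)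
    qed (simp add: seg_pt_def fun_eq_iff)
    moreover have "seg_pt j s k' r' = edge_pt j s k'"
    proof (cases "r' = 0")
      case False
      then have "edge_pt j s k' = edge_pt j s (Suc k')" using 3 edge_pos_step(2)[OF s] by auto
      then show ?thesis by (simp add: seg_pt_def algebra_simps fun_eq_iff)
    qed (simp add: seg_pt_def fun_eq_iff)
    ultimately show ?thesis using edge_pos_eq_edge_pt_eq[OF s lt 1] by simp
  qed
  obtain k r where k: "k < len j" "0 \<le> r" "r \<le> 1" "x = seg_pt j s k r" using x unfolding rep_def by blast
  obtain k' r' where k': "k' < len j" "0 \<le> r'" "r' \<le> 1" "x' = seg_pt j s k' r'" using x' unfolding rep_def by blast
  have "(1 - r) * edge_pos j s k + r * edge_pos j s (Suc k) = (1 - r') * edge_pos j s k' + r' * edge_pos j s (Suc k')"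
    using eq j k k' by (simp add: bary_pos_seg_pt)
  then show ?thesis using main[of k k' r r'] main[of k' k r' r] k k' by (cases "k \<le> k'") auto
qed

text \<open>The row shared by two slabs has two descriptions; converting one into the other resolves
  the ambiguity of the slab at integer levels.\<close>

lemma rep_next_slab:
  assumes "rep j 1 x"
  shows "rep (Suc j) 0 x"
proof -
  obtain k r where k: "k < len j" "0 \<le> r" "r \<le> 1" "x = seg_pt j 1 k r" using assms unfolding rep_def by blast
  define i where "i = u j k"
  have i: "i < n (Suc j)" using u_less[of k j] k by (simp add: i_def)
  consider "u j (Suc k) = i" | "u j (Suc k) = Suc i" using lu_step[of j k] by (auto simp: i_def)
  then show ?thesis
  proof cases
    case 1
    then have x: "x v = (if v = (Suc j, i) then 1 else 0)" for v
      by (auto simp: k(4) seg_pt_def edge_pt_def i_def)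
    show ?thesis
    proof (cases "Suc i < n (Suc j)")
      case True
      obtain k' where k': "k' < len (Suc j)" "l (Suc j) k' = i" "l (Suc j) (Suc k') = Suc i"
        using l_step_exists[OF True] by auto
      have "x = seg_pt (Suc j) 0 k' 0" using k' by (auto simp: fun_eq_iff x seg_pt_def edge_pt_def)
      then show ?thesis using k' unfolding rep_def by (intro exI[of _ k'] exI[of _ 0] conjI) auto
    next
      case False
      \<comment> \<open>The last vertex of a row starts no edge, so it is taken as the right end,
        \<open>r = 1\<close>, of the edge before it.\<close>
      then have lt: "Suc (i - 1) < n (Suc j)" "i > 0" using i n_ge4[of "Suc j"] by auto
      obtain k' where k': "k' < len (Suc j)" "l (Suc j) k' = i - 1" "l (Suc j) (Suc k') = Suc (i - 1)"
        using l_step_exists[OF lt(1)] by auto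
      have "x = seg_pt (Suc j) 0 k' 1" using k' lt by (auto simp: fun_eq_iff x seg_pt_def edge_pt_def)
      then show ?thesis using k' unfolding rep_def by (intro exI[of _ k'] exI[of _ 1] conjI) auto
    qed
  next
    case 2
    then have x: "x v = (if v = (Suc j, i) then 1 - r else if v = (Suc j, Suc i) then r else 0)" for v
      by (auto simp: k(4) seg_pt_def edge_pt_def i_def)
    have "Suc i < n (Suc j)" using u_less[of "Suc k" j] k(1) 2 by simp
    then obtain k' where k': "k' < len (Suc j)" "l (Suc j) k' = i" "l (Suc j) (Suc k') = Suc i"
      using l_step_exists[of i "Suc j"] by auto
    have "x = seg_pt (Suc j) 0 k' r" using k' by (auto simp: fun_eq_iff x seg_pt_def edge_pt_def)
    then show ?thesis using k k' unfolding rep_def by (intro exI[of _ k'] exI[of _ r] conjI) auto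
  qed
qed

definition level_sum :: "(nat \<times> nat \<Rightarrow> real) \<Rightarrow> real" where
  "level_sum = bary_sum W (\<lambda>v. real (fst v))"

lemma rep_level: "j < J \<Longrightarrow> rep j s x \<Longrightarrow> level_sum x = real j + s"
  unfolding rep_def level_sum_def using bary_level_seg_pt by blast

lemma realization_inj:
  assumes x: "x \<in> geometric_realization T" and x': "x' \<in> geometric_realization T"
    and eq: "level_sum x = level_sum x'" "bary_sum W pos x = bary_sum W pos x'"
  shows "x = x'"
proof -
  have main: "x = x'" if r: "j < J" "0 \<le> s" "s \<le> 1" "rep j s x" "j' < J" "0 \<le> s'" "s' \<le> 1" "rep j' s' x'"
    and le: "j \<le> j'" and eq: "level_sum x = level_sum x'" "bary_sum W pos x = bary_sum W pos x'"
    for x x' j s j' s'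
  proof -
    have h: "real j + s = real j' + s'" using eq(1) r rep_level by metis
    show ?thesis
    proof (cases "j = j'")
      case True
      then show ?thesis using h r eq rep_inj by simp
    next
      case False
      then have "real j + 1 \<le> real j'" using le by linarith
      then have *: "s = 1" "s' = 0" "j' = Suc j" using h r by linarith+
      then have "rep j' s' x" using rep_next_slab r by simp
      then show ?thesis using r eq rep_inj by blast
    qed
  qed
  obtain j s where r: "j < J" "0 \<le> s" "s \<le> 1" "rep j s x" using realization_rep[OF x] by blast
  obtain j' s' where r': "j' < J" "0 \<le> s'" "s' \<le> 1" "rep j' s' x'" using realization_rep[OF x'] by blast
  show ?thesis
    using main[OF r r' _ eq] main[OF r' r _ eq(1)[symmetric] eq(2)[symmetric]] by (cases "j \<le> j'") auto
qed

text \<open>A discrete intermediate value argument: the rung positions at a given height run from 0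
  to 1.\<close>

lemma realization_surj:
  assumes "0 \<le> t" "t \<le> real J" "0 \<le> y" "y \<le> 1"
  shows "\<exists>x\<in>geometric_realization T. level_sum x = t \<and> bary_sum W pos x = y"
proof -
  obtain j s where j: "j < J" "0 \<le> s" "s \<le> 1" "t = real j + s"
  proof (cases "t < real J")
    case True
    have "real (nat \<lfloor>t\<rfloor>) = of_int \<lfloor>t\<rfloor>" using assms(1) by simp
    then have "nat \<lfloor>t\<rfloor> < J" "0 \<le> t - real (nat \<lfloor>t\<rfloor>)" "t - real (nat \<lfloor>t\<rfloor>) \<le> 1"
      using True by linarith+
    then show ?thesis using that[of "nat \<lfloor>t\<rfloor>" "t - real (nat \<lfloor>t\<rfloor>)"] by simp
  next
    case False
    \<comment> \<open>The top level belongs to the last slab, at height 1.\<close>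
    then show ?thesis using assms J_ge3 that[of "J - 1" 1] by (simp add: of_nat_diff)
  qed
  have Y0: "edge_pos j s 0 = 0" by (simp add: edge_pos_def pos_def lu_0)
  have Yn: "edge_pos j s (len j) = 1" using n_ge4[of j] n_ge4[of "Suc j"]
    by (simp add: edge_pos_def pos_def l_len u_len of_nat_diff)
  have "\<exists>k<K. edge_pos j s k \<le> y \<and> y \<le> edge_pos j s (Suc k)" if "K > 0" "y \<le> edge_pos j s K" for K
    using that
  proof (induction K)
    case (Suc K)
    show ?case
    proof (cases "K > 0 \<and> y \<le> edge_pos j s K")
      case True
      then show ?thesis using Suc.IH less_Suc_eq by auto
    next
      case False
      then have "edge_pos j s K \<le> y" using Y0 assms(3) by (cases "K = 0") auto
      then show ?thesis using Suc.prems by auto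
    qed
  qed simp
  then obtain k where k: "k < len j" "edge_pos j s k \<le> y" "y \<le> edge_pos j s (Suc k)"
    using len_ge[of j] Yn assms(4) by (metis le_zero_eq neq0_conv numeral_eq_iff zero_neq_numeral)
  define d where "d = edge_pos j s (Suc k) - edge_pos j s k"
  define r where "r = (if d = 0 then 0 else (y - edge_pos j s k) / d)"
  have r: "0 \<le> r" "r \<le> 1" "r * d = y - edge_pos j s k" using k by (auto simp: r_def d_def field_simps)
  then have "(1 - r) * edge_pos j s k + r * edge_pos j s (Suc k) = y" by (simp add: d_def algebra_simps)
  moreover have rep: "rep j s (seg_pt j s k r)" using k r unfolding rep_def by blast
  ultimately show ?thesis
    using rep_realization[OF j(1-3) rep] rep_level[OF j(1) rep] j k(1)
    by (intro bexI[of _ "seg_pt j s k r"]) (auto simp: bary_pos_seg_pt)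
qed

end

section \<open>The double of the strip is a sphere\<close>

text \<open>An average reaches the upper bound only if every vertex of positive weight does.
  Boundary points of the square are thereby traced to simplices inside one side.\<close>

lemma bary_sum_extreme:
  assumes x: "x \<in> geometric_realization K" and W: "finite W" "\<Union>K \<subseteq> W"
    and g: "\<And>v. v \<in> W \<Longrightarrow> g v \<le> c"
  shows "bary_sum W g x \<le> c" "bary_sum W g x = c \<Longrightarrow> x v \<noteq> 0 \<Longrightarrow> g v = c"
proof -
  have nn: "\<And>v. 0 \<le> x v" and "{v. x v \<noteq> 0} \<in> K" using x by (auto simp: geometric_realization_def)
  then have sub: "{v. x v \<noteq> 0} \<subseteq> W" using W(2) by blast
  have "(\<Sum>v\<in>W. x v * c) = c" using realization_sum[OF x W] by (simp add: sum_distrib_right[symmetric])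
  then have eq: "c - bary_sum W g x = (\<Sum>v\<in>W. x v * (c - g v))"
    by (simp add: bary_sum_def right_diff_distrib sum_subtractf)
  have pos: "0 \<le> x v * (c - g v)" if "v \<in> W" for v using nn g[OF that] by simp
  then have "0 \<le> (\<Sum>v\<in>W. x v * (c - g v))" by (rule sum_nonneg)
  then show "bary_sum W g x \<le> c" using eq by linarith
  assume "bary_sum W g x = c" "x v \<noteq> 0"
  then have "v \<in> W" "(\<Sum>v\<in>W. x v * (c - g v)) = 0" using sub eq by auto
  then have "x v * (c - g v) = 0" using sum_nonneg_eq_0_iff[of W "\<lambda>v. x v * (c - g v)"] W(1) pos by blast
  then show "g v = c" using \<open>x v \<noteq> 0\<close> by simp
qed

lemma bary_sum_const_on_support:
  assumes x: "x \<in> geometric_realization K" and W: "finite W" "\<Union>K \<subseteq> W"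
    and g: "\<And>v. x v \<noteq> 0 \<Longrightarrow> g v = c"
  shows "bary_sum W g x = c"
proof -
  have "bary_sum W g x = (\<Sum>v\<in>W. x v * c)"
    unfolding bary_sum_def by (intro sum.cong refl) (metis g mult_zero_left)
  then show ?thesis using realization_sum[OF x W] by (simp add: sum_distrib_right[symmetric])
qed

lemma complexI:
  "(\<And>\<sigma>. \<sigma> \<in> K \<Longrightarrow> finite \<sigma> \<and> \<sigma> \<noteq> {}) \<Longrightarrow> (\<And>\<sigma> \<tau>. \<sigma> \<in> K \<Longrightarrow> \<tau> \<subseteq> \<sigma> \<Longrightarrow> \<tau> \<noteq> {} \<Longrightarrow> \<tau> \<in> K)
    \<Longrightarrow> abstract_simplicial_complex K"
  by (simp add: abstract_simplicial_complex_def)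

lemma complex_simplex: "abstract_simplicial_complex K \<Longrightarrow> \<sigma> \<in> K \<Longrightarrow> finite \<sigma> \<and> \<sigma> \<noteq> {}"
  by (simp add: abstract_simplicial_complex_def)

lemma complex_face: "abstract_simplicial_complex K \<Longrightarrow> \<sigma> \<in> K \<Longrightarrow> \<tau> \<subseteq> \<sigma> \<Longrightarrow> \<tau> \<noteq> {} \<Longrightarrow> \<tau> \<in> K"
  unfolding abstract_simplicial_complex_def by (drule conjunct2, drule (1) bspec, drule spec, erule mp, rule conjI)

lemma abstract_simplicial_complex_image:
  assumes K: "abstract_simplicial_complex K"
  shows "abstract_simplicial_complex ((`) f ` K)"
proof (rule complexI)
  fix \<sigma> assume "\<sigma> \<in> (`) f ` K"
  then show "finite \<sigma> \<and> \<sigma> \<noteq> {}" using complex_simplex[OF K] by auto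
next
  fix \<sigma> \<tau> assume "\<sigma> \<in> (`) f ` K" and t: "\<tau> \<subseteq> \<sigma>" "\<tau> \<noteq> {}"
  then obtain \<sigma>' where s: "\<sigma>' \<in> K" "\<sigma> = f ` \<sigma>'" by blast
  then obtain \<tau>' where t': "\<tau>' \<subseteq> \<sigma>'" "\<tau> = f ` \<tau>'" using t by (metis subset_imageE)
  then have "\<tau>' \<in> K" using complex_face[OF K s(1)] t(2) by simp
  then show "\<tau> \<in> (`) f ` K" using t'(2) by (rule rev_image_eqI)
qed

lemma abstract_simplicial_complex_Un:
  assumes "abstract_simplicial_complex A" "abstract_simplicial_complex B"
  shows "abstract_simplicial_complex (A \<union> B)"
proof (rule complexI)
  fix \<sigma> assume "\<sigma> \<in> A \<union> B"
  then show "finite \<sigma> \<and> \<sigma> \<noteq> {}" using complex_simplex[OF assms(1), of \<sigma>] complex_simplex[OF assms(2), of \<sigma>] by blast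
next
  fix \<sigma> \<tau> assume "\<sigma> \<in> A \<union> B" and t: "\<tau> \<subseteq> \<sigma>" "\<tau> \<noteq> {}"
  then show "\<tau> \<in> A \<union> B" using complex_face[OF assms(1) _ t] complex_face[OF assms(2) _ t] by (elim UnE) simp_all
qed

context strip begin

text \<open>The rear sheet is mirrored: in a plain double the diagonals cutting off two corners of the strip, which
  join boundary vertices, would be identified with their copies.\<close>

definition bd :: "nat \<times> nat \<Rightarrow> bool" where
  "bd v \<longleftrightarrow> fst v = 0 \<or> fst v = J \<or> snd v = 0 \<or> Suc (snd v) = n (fst v)"
definition mir :: "nat \<times> nat \<Rightarrow> nat \<times> nat" where "mir v = (fst v, n (fst v) - 1 - snd v)"
text \<open>Front vertices get even labels, and the rear vertices off the boundary get odd ones.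
  Halving the label always recovers a vertex of the correct level, since \<open>mir\<close>
  preserves levels.\<close>

definition front :: "nat \<times> nat \<Rightarrow> nat" where "front v = 2 * prod_encode v"
definition rear :: "nat \<times> nat \<Rightarrow> nat" where
  "rear v = (if bd v then front (mir v) else Suc (front (mir v)))"
definition K :: "nat set set" where "K = (`) front ` T \<union> (`) rear ` T"

lemma W_snd: "v \<in> W \<Longrightarrow> snd v < n (fst v)"
  by (auto simp: W_def)

lemma mir_mir: "v \<in> W \<Longrightarrow> mir (mir v) = v"
  by (auto simp: W_def mir_def)

lemma bd_mir: "v \<in> W \<Longrightarrow> bd (mir v) \<longleftrightarrow> bd v"
  by (auto simp: W_def mir_def bd_def)

lemma mir_image: "\<sigma> \<subseteq> W \<Longrightarrow> mir ` mir ` \<sigma> = \<sigma>"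
  using mir_mir by (force simp: image_image)

lemma inj_front: "inj front"
  by (auto simp: inj_def front_def)

lemma inj_mir: "inj_on mir W"
  by (rule inj_on_inverseI[of _ mir]) (rule mir_mir)

lemma inj_rear: "inj_on rear W"
proof (rule inj_onI)
  fix v w assume v: "v \<in> W" and w: "w \<in> W" and eq: "rear v = rear w"
  have "front (mir v) = front (mir w)" using eq unfolding rear_def front_def by (auto split: if_splits; presburger)
  then have "mir v = mir w" using inj_front by (simp add: inj_eq)
  then show "v = w" using v w inj_mir by (simp add: inj_on_eq_iff)
qed

lemma front_eq_rear: "front v = rear w \<Longrightarrow> bd w \<and> v = mir w"
proof -
  assume eq: "front v = rear w"
  have "bd w"
  proof (rule ccontr)
    assume "\<not> bd w"
    then have "2 * prod_encode v = Suc (2 * prod_encode (mir w))" using eq by (simp add: rear_def front_def)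
    then show False by presburger
  qed
  then show ?thesis using eq inj_front by (simp add: rear_def inj_eq)
qed

text \<open>Stronger than having all vertices on the boundary: a diagonal that cuts off a corner has
  boundary ends but lies in no side.\<close>

definition side :: "(nat \<times> nat) set \<Rightarrow> bool" where
  "side \<sigma> \<longleftrightarrow> (\<forall>v\<in>\<sigma>. fst v = 0) \<or> (\<forall>v\<in>\<sigma>. fst v = J) \<or> (\<forall>v\<in>\<sigma>. snd v = 0) \<or> (\<forall>v\<in>\<sigma>. Suc (snd v) = n (fst v))"

lemma side_bd: "side \<sigma> \<Longrightarrow> v \<in> \<sigma> \<Longrightarrow> bd v"
  by (auto simp: side_def bd_def)

text \<open>The strip is not symmetric under \<open>mir\<close> because of its diagonals, but rows
  are.\<close>

lemma level_mir_in_T: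
  assumes T: "\<sigma> \<in> T" and j: "\<forall>v\<in>\<sigma>. fst v = j"
  shows "mir ` \<sigma> \<in> T"
proof -
  have sW: "\<sigma> \<subseteq> W" using T_sub_W[OF T] .
  obtain v where "v \<in> \<sigma>" using T by (auto simp: T_def)
  then obtain i0 where i0: "(j, i0) \<in> \<sigma>" using j by (cases v) auto
  define i where "i = (LEAST i. (j, i) \<in> \<sigma>)"
  have i: "(j, i) \<in> \<sigma>" unfolding i_def by (rule LeastI[of _ i0]) (rule i0)
  have ij: "j \<le> J" "i < n j" using i sW by (auto simp: W_def)
  have sub: "w = (j, i) \<or> w = (j, Suc i) \<and> Suc i < n j" if "w \<in> \<sigma>" for w
  proof -
    obtain i' where w: "w = (j, i')" using j \<open>w \<in> \<sigma>\<close> by (cases w) auto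
    have "i \<le> i'" unfolding i_def by (rule Least_le) (use \<open>w \<in> \<sigma>\<close> w in simp)
    moreover have "i' \<le> Suc i" using T_edge_same[OF T i] \<open>w \<in> \<sigma>\<close> w by simp
    moreover have "i' < n j" using \<open>w \<in> \<sigma>\<close> w sW by (auto simp: W_def)
    ultimately show ?thesis using w by (auto simp: le_Suc_eq)
  qed
  have ne: "mir ` \<sigma> \<noteq> {}" using i by blast
  show ?thesis
  proof (cases "Suc i < n j")
    case True
    have "mir ` \<sigma> \<subseteq> {(j, n j - 2 - i), (j, Suc (n j - 2 - i))}"
      using True by (auto simp: mir_def dest!: sub)
    then show ?thesis using True ij ne by (intro horizontal_in_T[of j "n j - 2 - i"]) auto
  next
    case False
    then have "mir ` \<sigma> \<subseteq> {(j, 0), (j, Suc 0)}" by (auto simp: mir_def dest!: sub)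
    then show ?thesis using n_ge4[of j] ij ne by (intro horizontal_in_T[of j 0]) auto
  qed
qed

text \<open>The left and right sides of a slab are its first and last rung, which \<open>mir\<close>
  exchanges.\<close>

lemma side_mir_in_T:
  assumes T: "\<sigma> \<in> T" and side: "side \<sigma>"
  shows "mir ` \<sigma> \<in> T"
proof -
  obtain j k where jk: "j < J" "\<sigma> \<subseteq> E j k \<union> E j (Suc k)" using T by (rule T_E)
  then have lev: "fst v = j \<or> fst v = Suc j" if "v \<in> \<sigma>" for v using that by (auto simp: E_def)
  have ne: "mir ` \<sigma> \<noteq> {}" using T by (auto simp: T_def)
  consider "\<forall>v\<in>\<sigma>. fst v = 0" | "\<forall>v\<in>\<sigma>. fst v = J" | "\<forall>v\<in>\<sigma>. snd v = 0" | "\<forall>v\<in>\<sigma>. Suc (snd v) = n (fst v)"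
    using side unfolding side_def by blast
  then show ?thesis
  proof cases
    case 3
    then have "mir ` \<sigma> \<subseteq> E j (len j)" using lev by (fastforce simp: mir_def E_def l_len u_len)
    then show ?thesis using jk ne by (intro E_in_T[of j "len j"]) auto
  next
    case 4
    have "mir v \<in> E j 0" if "v \<in> \<sigma>" for v
      using 4 lev[OF that] that by (auto simp: mir_def E_def lu_0 dest!: bspec[of _ _ v])
    then have "mir ` \<sigma> \<subseteq> E j 0" by blast
    then show ?thesis using jk ne by (intro E_in_T[of j 0]) auto
  qed (use T level_mir_in_T in blast)+
qed

text \<open>A boundary edge could leave the left side only along the diagonal at the top corner,
  since rows have at least four vertices. The mirror image of that diagonal leans the wrong way and
  is not a simplex.\<close>

lemma no_chord_left:
  assumes T: "\<sigma> \<in> T" "mir ` \<sigma> \<in> T" and bd: "\<forall>v\<in>\<sigma>. bd v"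
    and v: "(j, 0) \<in> \<sigma>" "0 < j" "j < J" and w: "(j', i) \<in> \<sigma>"
  shows "i = 0"
proof -
  have lev: "j' \<le> Suc j" "j \<le> Suc j'" using T_edge_level[OF T(1)] v w by blast+
  have bw: "j' = 0 \<or> j' = J \<or> i = 0 \<or> Suc i = n j'" using bd w by (auto simp: bd_def)
  consider "j' = j" | "j' = Suc j" | "j = Suc j'" using lev by linarith
  then show ?thesis
  proof cases
    case 1
    then have "i \<le> 1" using T_edge_same[OF T(1) v(1)] w by simp
    then show ?thesis using bw 1 v n_ge4[of j'] by auto
  next
    case 2
    have "(Suc j, i) \<in> \<sigma>" using w 2 by simp
    from T_edge_vertical[OF T(1) v(1) this] have i1: "i \<le> 1" by (simp split: if_splits)
    show ?thesis
    proof (cases "j' = J")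
      case True
      \<comment> \<open>The last slab is plain, so its two rows are equally long and mirroring
        reverses the sign of the horizontal offset.\<close>
      then have nd: "\<not> dbl j" using not_dbl_last 2 by simp
      have "mir (j, 0) \<in> mir ` \<sigma>" "mir (j', i) \<in> mir ` \<sigma>" using v w by blast+
      then have "(j, n j - 1) \<in> mir ` \<sigma>" "(Suc j, n j - 1 - i) \<in> mir ` \<sigma>"
        using 2 nd by (simp_all add: mir_def n_Suc)
      from T_edge_vertical[OF T(2) this] nd have "n j - 1 \<le> n j - 1 - i" by simp
      then show ?thesis using n_ge4[of j] by linarith
    qed (use bw i1 2 n_ge4[of j'] in auto)
  next
    case 3
    then have "(Suc j', 0) \<in> \<sigma>" using v by simp
    from T_edge_vertical[OF T(1) w this] show ?thesis by (simp split: if_splits)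
  qed
qed

lemma common_simplex_side:
  assumes T: "\<sigma> \<in> T" "mir ` \<sigma> \<in> T" and bd: "\<forall>v\<in>\<sigma>. bd v"
  shows "side \<sigma>"
proof (cases "(\<forall>v\<in>\<sigma>. fst v = 0) \<or> (\<forall>v\<in>\<sigma>. fst v = J)")
  case True
  then show ?thesis by (auto simp: side_def)
next
  case False
  then obtain v w where vw: "v \<in> \<sigma>" "fst v \<noteq> 0" "w \<in> \<sigma>" "fst w \<noteq> J" by blast
  have sW: "\<sigma> \<subseteq> W" using T_sub_W[OF T(1)] .
  \<comment> \<open>A simplex spans at most two adjacent levels and \<open>J \<ge> 3\<close>, so it
    cannot meet both end levels.\<close>
  have "\<exists>z\<in>\<sigma>. 0 < fst z \<and> fst z < J"
  proof (cases "fst v = J")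
    case True
    have "J \<le> Suc (fst w)"
      using T_edge_level[OF T(1), of "fst w" "snd w" "fst v" "snd v"] vw True
      unfolding prod.collapse by simp
    then have "0 < fst w" using J_ge3 by linarith
    moreover have "fst w \<le> J" using vw sW by (auto simp: W_def)
    ultimately show ?thesis using vw by force
  next
    case False
    moreover have "fst v \<le> J" using vw sW by (auto simp: W_def)
    ultimately show ?thesis using vw by force
  qed
  then obtain j i where z: "(j, i) \<in> \<sigma>" "0 < j" "j < J" by auto
  then have "i = 0 \<or> Suc i = n j" using bd by (auto simp: bd_def)
  then show ?thesis
  proof
    assume "i = 0"
    then have "\<forall>v\<in>\<sigma>. snd v = 0" using no_chord_left[OF T bd _ z(2,3)] z by auto
    then show ?thesis by (simp add: side_def)
  next
    \<comment> \<open>The right side is reduced to the left one by exchanging the roles of the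
      simplex and its mirror image.\<close>
    assume i: "Suc i = n j"
    have "mir (j, i) = (j, 0)" using i by (simp add: mir_def)
    then have z': "(j, 0) \<in> mir ` \<sigma>" using z by (metis image_eqI)
    have bd': "\<forall>v\<in>mir ` \<sigma>. bd v" using bd sW bd_mir by auto
    have T': "mir ` mir ` \<sigma> \<in> T" using T sW by (simp add: mir_image)
    have "Suc (snd v) = n (fst v)" if "v \<in> \<sigma>" for v
    proof -
      have "snd (mir v) = 0"
        using no_chord_left[OF T(2) T' bd' z' z(2,3), of "fst (mir v)" "snd (mir v)"] that by simp
      moreover have "snd v < n (fst v)" using that sW W_snd by blast
      ultimately show ?thesis by (simp add: mir_def)
    qed
    then show ?thesis by (simp add: side_def)
  qed
qed

definition xc :: "nat \<times> nat \<Rightarrow> real" where "xc v = 2 * real (fst v) / real J - 1"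
definition yc :: "nat \<times> nat \<Rightarrow> real" where "yc v = 2 * pos v - 1"
definition square_map :: "(nat \<times> nat \<Rightarrow> real) \<Rightarrow> real \<times> real" where "square_map x = (bary_sum W xc x, bary_sum W yc x)"

lemma pos_bounds: "v \<in> W \<Longrightarrow> 0 \<le> pos v \<and> pos v \<le> 1"
  using W_snd[of v] n1_pos[of "fst v"] by (auto simp: pos_def field_simps)

lemma coord_bounds: 
  assumes "v \<in> W" shows "\<bar>xc v\<bar> \<le> 1" "\<bar>yc v\<bar> \<le> 1"
  using assms pos_bounds[OF assms] J_ge3 by (auto simp: xc_def yc_def W_def field_simps abs_le_iff)

lemma xc_eq: "xc v = -1 \<longleftrightarrow> fst v = 0" "xc v = 1 \<longleftrightarrow> fst v = J"
  using J_ge3 by (auto simp: xc_def field_simps)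

lemma yc_eq: "yc v = -1 \<longleftrightarrow> snd v = 0" "yc v = 1 \<longleftrightarrow> Suc (snd v) = n (fst v)"
  using n1_pos[of "fst v"] n_ge4[of "fst v"] by (auto simp: yc_def pos_def field_simps)

lemma xc_mir: "xc (mir v) = xc v"
  by (simp add: xc_def mir_def)

lemma yc_mir: "v \<in> W \<Longrightarrow> yc (mir v) = - yc v"
  using W_snd[of v] n1_pos[of "fst v"] by (auto simp: yc_def pos_def mir_def of_nat_diff field_simps)

lemma UT: "\<Union>T \<subseteq> W" using Union_T by simp

lemma square_map_eq:
  assumes "x \<in> geometric_realization T"
  shows "square_map x = (2 * level_sum x / real J - 1, 2 * bary_sum W pos x - 1)"
proof -
  have s: "(\<Sum>v\<in>W. x v) = 1" by (rule realization_sum[OF assms finite_W UT])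
  have "bary_sum W xc x = (\<Sum>v\<in>W. 2 / real J * (x v * real (fst v)) - x v)"
    unfolding bary_sum_def by (intro sum.cong) (auto simp: xc_def algebra_simps)
  also have "\<dots> = 2 / real J * level_sum x - 1"
    by (simp add: sum_subtractf s level_sum_def bary_sum_def sum_distrib_left)
  finally have 1: "bary_sum W xc x = 2 * level_sum x / real J - 1" by simp
  have "bary_sum W yc x = (\<Sum>v\<in>W. 2 * (x v * pos v) - x v)"
    unfolding bary_sum_def by (intro sum.cong) (auto simp: yc_def algebra_simps)
  also have "\<dots> = 2 * bary_sum W pos x - 1"
    by (simp add: sum_subtractf s bary_sum_def sum_distrib_left)
  finally show ?thesis using 1 by (simp add: square_map_def)
qed

lemma bij_square_map: "bij_betw square_map (geometric_realization T) {p. boxnorm p \<le> 1}"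
proof (rule bij_betw_imageI)
  have J0: "real J > 0" using J_ge3 by simp
  show "inj_on square_map (geometric_realization T)"
    using realization_inj J0 by (auto simp: inj_on_def square_map_eq)
  show "square_map ` geometric_realization T = {p. boxnorm p \<le> 1}"
  proof (intro equalityI subsetI)
    fix p assume "p \<in> square_map ` geometric_realization T"
    then obtain x where x: "x \<in> geometric_realization T" "p = square_map x" by blast
    have b: "bary_sum W g x \<le> 1" if "\<And>v. v \<in> W \<Longrightarrow> g v \<le> 1" for g
      using bary_sum_extreme(1)[OF x(1) finite_W UT that] .
    have m: "bary_sum W (\<lambda>v. - g v) x = - bary_sum W g x" for g by (simp add: bary_sum_def sum_negf)
    have "bary_sum W xc x \<le> 1" "bary_sum W yc x \<le> 1" "- bary_sum W xc x \<le> 1" "- bary_sum W yc x \<le> 1"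
      unfolding m[symmetric] by (rule b; use coord_bounds in \<open>force simp: abs_le_iff\<close>)+
    then show "p \<in> {p. boxnorm p \<le> 1}" using x by (auto simp: square_map_def boxnorm_def)
  next
    fix p :: "real \<times> real" assume "p \<in> {p. boxnorm p \<le> 1}"
    then have p: "\<bar>fst p\<bar> \<le> 1" "\<bar>snd p\<bar> \<le> 1" by (auto simp: boxnorm_def)
    have "0 \<le> (fst p + 1) / 2 * real J" "(fst p + 1) / 2 * real J \<le> 1 * real J" 
      using p J0 by (intro mult_nonneg_nonneg mult_right_mono; simp add: abs_le_iff)+
    moreover have "0 \<le> (snd p + 1) / 2" "(snd p + 1) / 2 \<le> 1" using p by (auto simp: abs_le_iff)
    ultimately obtain x where x: "x \<in> geometric_realization T"
      "level_sum x = (fst p + 1) / 2 * real J" "bary_sum W pos x = (snd p + 1) / 2"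
      using realization_surj[of "(fst p + 1) / 2 * real J" "(snd p + 1) / 2"] by auto
    then have "square_map x = p" using J0 unfolding square_map_eq[OF x(1)] x(2,3) by (simp add: prod_eq_iff field_simps)
    then show "p \<in> square_map ` geometric_realization T" using x(1) by blast
  qed
qed

lemma square_map_boundary_side:
  assumes x: "x \<in> geometric_realization T" and N: "boxnorm (square_map x) = 1"
  shows "side {v. x v \<noteq> 0}"
proof -
  have m: "bary_sum W (\<lambda>v. - g v) x = - bary_sum W g x" for g by (simp add: bary_sum_def sum_negf)
  have ex: "bary_sum W g x = 1 \<Longrightarrow> x v \<noteq> 0 \<Longrightarrow> g v = 1" if "\<And>v. v \<in> W \<Longrightarrow> g v \<le> 1" for g v
    by (rule bary_sum_extreme(2)[OF x finite_W UT that])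
  have "\<bar>bary_sum W xc x\<bar> = 1 \<or> \<bar>bary_sum W yc x\<bar> = 1"
    using N unfolding square_map_def boxnorm_def by (auto simp: max_def split: if_splits)
  then have "bary_sum W xc x = 1 \<or> - bary_sum W xc x = 1 \<or> bary_sum W yc x = 1 \<or> - bary_sum W yc x = 1"
    by linarith
  then consider "bary_sum W xc x = 1" | "bary_sum W (\<lambda>v. - xc v) x = 1"
    | "bary_sum W yc x = 1" | "bary_sum W (\<lambda>v. - yc v) x = 1"
    unfolding m by blast
  then show ?thesis
  proof cases
    case 1
    have "xc v = 1" if "x v \<noteq> 0" for v by (rule ex[OF _ 1 that]) (use coord_bounds in force)
    then show ?thesis unfolding side_def xc_eq by simp
  next
    case 2
    have neg: "- xc v = 1" if "x v \<noteq> 0" for v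
      by (rule ex[OF _ 2 that]) (use coord_bounds in \<open>force simp: abs_le_iff\<close>)
    have "xc v = -1" if "x v \<noteq> 0" for v using neg[OF that] by simp
    then show ?thesis unfolding side_def xc_eq by simp
  next
    case 3
    have "yc v = 1" if "x v \<noteq> 0" for v by (rule ex[OF _ 3 that]) (use coord_bounds in force)
    then show ?thesis unfolding side_def yc_eq by simp
  next
    case 4
    have neg: "- yc v = 1" if "x v \<noteq> 0" for v
      by (rule ex[OF _ 4 that]) (use coord_bounds in \<open>force simp: abs_le_iff\<close>)
    have "yc v = -1" if "x v \<noteq> 0" for v using neg[OF that] by simp
    then show ?thesis unfolding side_def yc_eq by simp
  qed
qed

lemma side_square_map_boundary:
  assumes x: "x \<in> geometric_realization T" and side: "side {v. x v \<noteq> 0}"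
  shows "boxnorm (square_map x) = 1"
proof -
  have c: "bary_sum W g x = c" if "\<And>v. x v \<noteq> 0 \<Longrightarrow> g v = c" for g c
    using bary_sum_const_on_support[OF x finite_W UT that] .
  have "\<bar>bary_sum W xc x\<bar> = 1 \<or> \<bar>bary_sum W yc x\<bar> = 1"
  proof -
    have "(\<forall>v. x v \<noteq> 0 \<longrightarrow> xc v = -1) \<or> (\<forall>v. x v \<noteq> 0 \<longrightarrow> xc v = 1) \<or>
        (\<forall>v. x v \<noteq> 0 \<longrightarrow> yc v = -1) \<or> (\<forall>v. x v \<noteq> 0 \<longrightarrow> yc v = 1)"
      using side unfolding side_def xc_eq yc_eq by blast
    then have "bary_sum W xc x = -1 \<or> bary_sum W xc x = 1 \<or> bary_sum W yc x = -1 \<or> bary_sum W yc x = 1"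
      using c[of xc "-1"] c[of xc 1] c[of yc "-1"] c[of yc 1] by blast
    then show ?thesis by auto
  qed
  moreover have "boxnorm (square_map x) \<le> 1" using bij_betwE[OF bij_square_map] x by blast
  ultimately show ?thesis unfolding square_map_def boxnorm_def by (simp add: max_def split: if_splits; linarith)
qed

definition refl2 :: "real \<times> real \<Rightarrow> real \<times> real" where "refl2 p = (fst p, - snd p)"

lemma T_complex: "abstract_simplicial_complex T"
proof (rule complexI)
  fix \<sigma> assume "\<sigma> \<in> T"
  then show "finite \<sigma> \<and> \<sigma> \<noteq> {}" using finite_subset[OF T_sub_W finite_W] by (simp add: T_def)
qed (rule T_down)

text \<open>The rear sheet is glued along \<open>mir\<close>, which reverses the second coordinate;
  composing its chart with \<open>refl2\<close> makes the two charts agree on the seam.\<close>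

lemma K_homeomorphic_sphere: "geometric_realization K homeomorphic (sphere 0 1 :: (real ^ 3) set)"
proof -
  let ?A = "geometric_realization ((`) front ` T)" and ?B = "geometric_realization ((`) rear ` T)"
  let ?f = "\<lambda>x. square_map (pull W front x)" and ?g = "\<lambda>x. refl2 (square_map (pull W rear x))"
  have injf: "inj_on front W" using inj_front by (rule inj_on_subset) simp
  have cont: "continuous_on S (\<lambda>x. bary_sum W h (pull W \<iota> x))"
    for S and h :: "nat \<times> nat \<Rightarrow> real" and \<iota> :: "nat \<times> nat \<Rightarrow> nat"
  proof -
    have "continuous_on S (\<lambda>x :: nat \<Rightarrow> real. \<Sum>v\<in>W. x (\<iota> v) * h v)"
      by (intro continuous_intros continuous_on_subset[OF continuous_on_product_coordinates]) auto
    moreover have "bary_sum W h (pull W \<iota> x) = (\<Sum>v\<in>W. x (\<iota> v) * h v)" for x :: "nat \<Rightarrow> real"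
      unfolding bary_sum_def pull_def by (intro sum.cong) auto
    ultimately show ?thesis by simp
  qed
  have "(?A \<union> ?B) homeomorphic (sphere 0 1 :: (real ^ 3) set)"
  proof (rule doubled_square_homeomorphic_sphere[of _ _ ?f ?g])
    show "compact ?A" "compact ?B"
      using finite_T T_complex by (auto intro!: compact_realization abstract_simplicial_complex_image)
    show "continuous_on ?A ?f" unfolding square_map_def by (intro continuous_intros cont)
    show "continuous_on ?B ?g" unfolding square_map_def refl2_def fst_conv snd_conv by (intro continuous_intros cont)
    show "bij_betw ?f ?A {p. boxnorm p \<le> 1}"
      using bij_betw_trans[OF bij_betw_pull[OF injf UT] bij_square_map] by (simp add: comp_def)
    have "bij_betw refl2 {p. boxnorm p \<le> 1} {p. boxnorm p \<le> 1}"
      by (rule bij_betw_byWitness[of _ refl2]) (auto simp: refl2_def boxnorm_def)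
    then show "bij_betw ?g ?B {p. boxnorm p \<le> 1}"
      using bij_betw_trans[OF bij_betw_trans[OF bij_betw_pull[OF inj_rear UT] bij_square_map]] by (simp add: comp_def)
  next
    fix x assume xA: "x \<in> ?A" and xB: "x \<in> ?B"
    let ?y = "pull W front x" and ?z = "pull W rear x"
    let ?s = "{v. ?y v \<noteq> 0}" and ?t = "{v. ?z v \<noteq> 0}"
    have y: "?y \<in> geometric_realization T"
      using bij_betwE[OF bij_betw_pull[OF injf UT]] xA by blast
    have s: "?s \<in> T" "{w. x w \<noteq> 0} = front ` ?s" using realization_image_support[OF injf UT xA] by auto
    have t: "?t \<in> T" "{w. x w \<noteq> 0} = rear ` ?t" using realization_image_support[OF inj_rear UT xB] by auto
    have tW: "?t \<subseteq> W" using T_sub_W[OF t(1)] .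
    have sW: "?s \<subseteq> W" using T_sub_W[OF s(1)] .
    have tbd: "bd w" if "w \<in> ?t" for w
    proof -
      have "rear w \<in> front ` ?s" using that s t by blast
      then obtain v where "front v = rear w" by (metis imageE)
      then show ?thesis using front_eq_rear by blast
    qed
    then have "rear ` ?t = front ` mir ` ?t" unfolding image_image by (intro image_cong) (auto simp: rear_def)
    then have "front ` ?s = front ` mir ` ?t" using s(2) t(2) by simp
    \<comment> \<open>A common point is seen by the two sheets on mirrored simplices, which is the
      situation of \<open>common_simplex_side\<close>.\<close>
    then have st: "?s = mir ` ?t" using inj_front by (simp add: inj_image_eq_iff)
    have ts: "mir ` ?s = ?t" using st mir_image[OF tW] by simp
    have red: "bary_sum W h (pull W \<iota> x) = (\<Sum>v\<in>{v. pull W \<iota> x v \<noteq> 0}. x (\<iota> v) * h v)"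
      for h and \<iota> :: "nat \<times> nat \<Rightarrow> nat"
      unfolding bary_sum_def
      by (rule sum.mono_neutral_cong_right[OF finite_W]) (auto simp: pull_def split: if_splits)
    have tr: "bary_sum W h ?y = (\<Sum>w\<in>?t. x (rear w) * h (mir w))" for h
    proof -
      have "bary_sum W h ?y = (\<Sum>v\<in>mir ` ?t. x (front v) * h v)" unfolding red st ..
      also have "\<dots> = (\<Sum>w\<in>?t. x (front (mir w)) * h (mir w))"
        using sum.reindex[OF inj_on_subset[OF inj_mir tW]] by simp
      also have "\<dots> = (\<Sum>w\<in>?t. x (rear w) * h (mir w))"
        using tbd by (intro sum.cong) (auto simp: rear_def)
      finally show ?thesis .
    qed
    have "(\<Sum>w\<in>?t. x (rear w) * yc (mir w)) = (\<Sum>w\<in>?t. - (x (rear w) * yc w))"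
      using tW by (intro sum.cong) (auto simp: yc_mir)
    then have "?f x = ?g x"
      unfolding square_map_def refl2_def tr by (simp add: red[of _ rear] xc_mir sum_negf)
    moreover have "side ?s"
    proof (rule common_simplex_side[OF s(1)])
      show "mir ` ?s \<in> T" using ts t(1) by simp
      show "\<forall>v\<in>?s. bd v" unfolding st using tbd tW bd_mir by blast
    qed
    ultimately show "?f x = ?g x \<and> boxnorm (?f x) = 1" using side_square_map_boundary[OF y] by simp
  next
    fix x assume xA: "x \<in> ?A" and N: "boxnorm (?f x) = 1"
    let ?y = "pull W front x"
    let ?s = "{v. ?y v \<noteq> 0}"
    have y: "?y \<in> geometric_realization T"
      using bij_betwE[OF bij_betw_pull[OF injf UT]] xA by blast
    have s: "?s \<in> T" "{w. x w \<noteq> 0} = front ` ?s" using realization_image_support[OF injf UT xA] by auto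
    have side: "side ?s" by (rule square_map_boundary_side[OF y N])
    have sW: "?s \<subseteq> W" using T_sub_W[OF s(1)] .
    \<comment> \<open>On boundary vertices \<open>rear\<close> is \<open>front\<close> after
      \<open>mir\<close>, so the support is also the rear copy of the mirrored simplex.\<close>
    have "rear ` mir ` ?s = front ` mir ` mir ` ?s"
      unfolding image_image using side_bd[OF side] sW bd_mir by (intro image_cong) (auto simp: rear_def)
    then have "{w. x w \<noteq> 0} = rear ` mir ` ?s" using s(2) mir_image[OF sW] by simp
    then have "{w. x w \<noteq> 0} \<in> (`) rear ` T" using side_mir_in_T[OF s(1) side] by blast
    then show "x \<in> ?B" using xA by (simp add: geometric_realization_def)
  qed
  then show ?thesis by (simp add: K_def realization_Un)
qed

lemma K_sphere_triangulation: "sphere_triangulation K"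
  unfolding sphere_triangulation_def
  using K_homeomorphic_sphere finite_T T_complex
  by (auto simp: K_def intro!: abstract_simplicial_complex_Un abstract_simplicial_complex_image)

end

section \<open>The Poincare inequality on the strip\<close>

lemma sum_double: "(\<Sum>i<2 * (k::nat). f i) = (\<Sum>i<k. f (2 * i) + f (Suc (2 * i)) :: real)"
  by (induction k) (simp_all add: add.assoc)

text \<open>The parameter is chosen as 1 / (10 L) on plain slabs, to lose little per level, and as
  1/2 on doubling slabs, where the gain of a factor 2 can absorb it.\<close>

lemma square_le_weighted:
  assumes "(e::real) > 0"
  shows "a\<^sup>2 \<le> (1 + e) * b\<^sup>2 + (1 + 1 / e) * (a - b)\<^sup>2"
proof -
  have "0 \<le> (e * b - (a - b))\<^sup>2 / e" using assms by simp
  also have "\<dots> = (1 + e) * b\<^sup>2 + (1 + 1 / e) * (a - b)\<^sup>2 - a\<^sup>2"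
    using assms by (simp add: field_simps power2_eq_square)
  finally show ?thesis by simp
qed

text \<open>Telescoping and Cauchy-Schwarz.\<close>

lemma square_diff_le_path:
  fixes f :: "nat \<Rightarrow> real"
  assumes "a < N" "b < N"
  shows "(f a - f b)\<^sup>2 \<le> real N * (\<Sum>i<N - 1. (f (Suc i) - f i)\<^sup>2)"
proof -
  have main: "(f b - f a)\<^sup>2 \<le> real N * (\<Sum>i<N - 1. (f (Suc i) - f i)\<^sup>2)" if "a \<le> b" "b < N" for a b
  proof -
    have "(f b - f a)\<^sup>2 = (\<Sum>i=a..<b. f (Suc i) - f i)\<^sup>2" using that by (simp add: sum_Suc_diff')
    also have "\<dots> \<le> (\<Sum>i=a..<b. (f (Suc i) - f i)\<^sup>2) * real (card {a..<b})"
      by (rule sum_squared_le_sum_of_squares)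
    also have "\<dots> \<le> (\<Sum>i<N - 1. (f (Suc i) - f i)\<^sup>2) * real N"
      using that by (intro mult_mono sum_mono2 sum_nonneg) auto
    finally show ?thesis by (simp add: mult.commute)
  qed
  show ?thesis
    using main[of a b] main[of b a] assms by (cases "a \<le> b") (auto simp: power2_commute)
qed

context strip begin

definition NT :: "nat \<times> nat \<Rightarrow> (nat \<times> nat) set" where "NT v = {w. w \<noteq> v \<and> {v, w} \<in> T}"

definition mass :: "(nat \<times> nat \<Rightarrow> real) \<Rightarrow> nat \<Rightarrow> real" where
  "mass g j = (\<Sum>i<n j. (g (j, i))\<^sup>2)"
text \<open>Only the edges to the one or two successors on the next level are kept; the successor
  sets of a level partition the next one, as the mass recursion needs.\<close>

definition up_energy :: "(nat \<times> nat \<Rightarrow> real) \<Rightarrow> nat \<Rightarrow> nat \<Rightarrow> real" where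
  "up_energy g j i = (if dbl j then (g (j, i) - g (Suc j, 2 * i))\<^sup>2 + (g (j, i) - g (Suc j, Suc (2 * i)))\<^sup>2
     else (g (j, i) - g (Suc j, i))\<^sup>2)"
definition slab_energy :: "(nat \<times> nat \<Rightarrow> real) \<Rightarrow> nat \<Rightarrow> real" where
  "slab_energy g j = (\<Sum>i<n j. up_energy g j i)"
definition top_energy :: "(nat \<times> nat \<Rightarrow> real) \<Rightarrow> real" where
  "top_energy g = (\<Sum>i<n J - 1. (g (J, Suc i) - g (J, i))\<^sup>2)"

lemma mass_nonneg: "0 \<le> mass g j" by (simp add: mass_def sum_nonneg)
lemma slab_energy_nonneg: "0 \<le> slab_energy g j" by (simp add: slab_energy_def up_energy_def sum_nonneg)
lemma top_energy_nonneg: "0 \<le> top_energy g" by (simp add: top_energy_def sum_nonneg)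

lemma mass_step:
  assumes "\<not> dbl j" "(r::real) > 0"
  shows "mass g j \<le> (1 + r) * mass g (Suc j) + (1 + 1 / r) * slab_energy g j"
proof -
  have "mass g j \<le> (\<Sum>i<n j. (1 + r) * (g (Suc j, i))\<^sup>2 + (1 + 1 / r) * (g (j, i) - g (Suc j, i))\<^sup>2)"
    unfolding mass_def by (intro sum_mono square_le_weighted assms)
  also have "\<dots> = (1 + r) * mass g (Suc j) + (1 + 1 / r) * slab_energy g j"
    using assms by (simp add: mass_def slab_energy_def up_energy_def n_Suc sum.distrib sum_distrib_left)
  finally show ?thesis .
qed

text \<open>The drift towards the wide end: averaging two upper neighbours halves the mass.\<close>
lemma mass_step_double:
  assumes "dbl j"
  shows "mass g j \<le> 3 / 4 * mass g (Suc j) + 3 / 2 * slab_energy g j"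
proof -
  have "(g (j, i))\<^sup>2 \<le> 3 / 4 * ((g (Suc j, 2 * i))\<^sup>2 + (g (Suc j, Suc (2 * i)))\<^sup>2)
      + 3 / 2 * ((g (j, i) - g (Suc j, 2 * i))\<^sup>2 + (g (j, i) - g (Suc j, Suc (2 * i)))\<^sup>2)" for i
    \<comment> \<open>The mean of the two instances: (1 + 1/2) / 2 = 3/4 and (1 + 2) / 2 =
      3/2.\<close>
    using square_le_weighted[of "1/2" "g (j, i)" "g (Suc j, 2 * i)"]
      square_le_weighted[of "1/2" "g (j, i)" "g (Suc j, Suc (2 * i))"] by (simp add: field_simps)
  then have "mass g j \<le> (\<Sum>i<n j. 3 / 4 * ((g (Suc j, 2 * i))\<^sup>2 + (g (Suc j, Suc (2 * i)))\<^sup>2)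
      + 3 / 2 * ((g (j, i) - g (Suc j, 2 * i))\<^sup>2 + (g (j, i) - g (Suc j, Suc (2 * i)))\<^sup>2))"
    unfolding mass_def by (intro sum_mono)
  also have "\<dots> = 3 / 4 * mass g (Suc j) + 3 / 2 * slab_energy g j"
    using assms by (simp only: mass_def slab_energy_def up_energy_def n_Suc if_True sum_double
        sum.distrib sum_distrib_left[symmetric])
  finally show ?thesis .
qed

text \<open>The coefficient is a supersolution of the recursion \<open>c' = 1 + c q\<close>, where \<open>q = 1 + 1 / (10 L)\<close> on
  plain slabs and \<open>q = 3 / 4\<close> on doubling slabs.\<close>
lemma mass_sum_le:
  "(\<Sum>j\<le>k. mass g j) \<le> real (8 * L + 2 * (k mod L)) * mass g k + 110 * (real L)\<^sup>2 * (\<Sum>j<k. slab_energy g j)"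
proof (induction k)
  case 0
  have "1 * mass g 0 \<le> real (8 * L) * mass g 0"
    using L_ge4 by (intro mult_right_mono mass_nonneg) linarith
  then show ?case by simp
next
  case (Suc k)
  define c where "c = real (8 * L + 2 * (k mod L))"
  have L1: "real L \<ge> 4" using L_ge4 by simp
  have kL: "k mod L < L" using L_ge4 by simp
  then have c: "0 \<le> c" "c \<le> 10 * real L - 2" by (simp_all add: c_def)
  have D0: "0 \<le> slab_energy g k" and M0: "0 \<le> mass g (Suc k)" by (rule slab_energy_nonneg, rule mass_nonneg)
  have "(\<Sum>j\<le>Suc k. mass g j) \<le> mass g (Suc k) + c * mass g k + 110 * (real L)\<^sup>2 * (\<Sum>j<k. slab_energy g j)"
    using Suc by (simp add: c_def)
  also have "mass g (Suc k) + c * mass g k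
     \<le> real (8 * L + 2 * (Suc k mod L)) * mass g (Suc k) + 110 * (real L)\<^sup>2 * slab_energy g k"
  proof (cases "dbl k")
    case False
    then have "Suc k mod L = Suc (k mod L)" by (auto simp: dbl_def mod_Suc dvd_eq_mod_eq_0)
    then have c': "real (8 * L + 2 * (Suc k mod L)) = c + 2" by (simp add: c_def)
    define \<epsilon> where "\<epsilon> = 1 / (10 * real L)"
    have eps: "\<epsilon> > 0" "1 / \<epsilon> = 10 * real L" using L1 by (simp_all add: \<epsilon>_def)
    have ce: "c * \<epsilon> \<le> 1" using c L1 by (simp add: \<epsilon>_def field_simps)
    have "c * mass g k \<le> c * ((1 + \<epsilon>) * mass g (Suc k) + (1 + 1 / \<epsilon>) * slab_energy g k)"
      by (intro mult_left_mono mass_step[OF False eps(1)] c)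
    also have "\<dots> = (c + c * \<epsilon>) * mass g (Suc k) + c * (1 + 10 * real L) * slab_energy g k"
      unfolding eps(2) by (simp add: algebra_simps)
    \<comment> \<open>Here \<open>c * \<epsilon> \<le> 1\<close> and
      \<open>1 + 10 * L \<le> 11 * L\<close>; the product of 10 and 11 is the constant 110.\<close>
    also have "\<dots> \<le> (c + 1) * mass g (Suc k) + (10 * real L * (11 * real L)) * slab_energy g k"
      using c L1 ce D0 M0 by (intro add_mono mult_right_mono mult_mono) auto
    finally show ?thesis unfolding c' by (simp add: power2_eq_square algebra_simps)
  next
    case True
    then have "Suc k mod L = 0" by (simp add: dbl_def dvd_eq_mod_eq_0)
    then have c': "real (8 * L + 2 * (Suc k mod L)) = 8 * real L" by simp
    have "c * mass g k \<le> c * (3 / 4 * mass g (Suc k) + 3 / 2 * slab_energy g k)"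
      by (intro mult_left_mono mass_step_double[OF True] c)
    also have "\<dots> = (c * (3 / 4)) * mass g (Suc k) + (c * (3 / 2)) * slab_energy g k"
      by (simp add: algebra_simps)
    also have "\<dots> \<le> (8 * real L - 1) * mass g (Suc k) + (110 * (real L)\<^sup>2) * slab_energy g k"
    proof (intro add_mono mult_right_mono D0 M0)
      \<comment> \<open>The coefficient climbs by 2 per level to at most \<open>10 * L - 2\<close>;
        a doubling slab takes off a quarter, which leaves room for the restart at
        \<open>8 * L\<close>.\<close>
      show "c * (3 / 4) \<le> 8 * real L - 1" using c L1 by linarith
      have "c * (3 / 2) \<le> 110 * real L * 1" using c L1 by linarith
      also have "\<dots> \<le> 110 * real L * real L" using L1 by (intro mult_left_mono) auto
      finally show "c * (3 / 2) \<le> 110 * (real L)\<^sup>2" by (simp add: power2_eq_square mult.assoc)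
    qed
    finally show ?thesis unfolding c' by (simp add: algebra_simps)
  qed
  finally show ?case by (simp add: algebra_simps)
qed

lemma n_J: "n J = 2 * 2 ^ m"
proof -
  have "J div L = m - 1"
  proof (rule div_nat_eqI)
    have "m * L = L * (m - 1) + L" using m_pos by (cases m) auto
    then show "L * (m - 1) \<le> J" "J < L * Suc (m - 1)" using L_ge4 m_pos by (auto simp: J_def algebra_simps)
  qed
  then show ?thesis using power_minus_mult[OF m_pos, of "2 :: nat"] by (simp add: n_def)
qed

lemma n_J_square: "(real (n J))\<^sup>2 = 4 * real L"
  by (simp add: n_J L_def power_mult_distrib power_even_eq[symmetric] power_mult)

text \<open>The path along the top row costs \<open>n J\<close> at each of its \<open>n J\<close>
  vertices, and \<open>(n J)\<^sup>2 = 4 * L\<close>.\<close>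

lemma top_mass_le:
  assumes "i0 < n J" "g (J, i0) = 0"
  shows "mass g J \<le> 4 * real L * top_energy g"
proof -
  have "mass g J \<le> (\<Sum>i<n J. real (n J) * top_energy g)"
    unfolding mass_def
  proof (intro sum_mono)
    fix i assume "i \<in> {..<n J}"
    then have "(g (J, i) - g (J, i0))\<^sup>2 \<le> real (n J) * top_energy g"
      using assms(1) square_diff_le_path[of i "n J" i0 "\<lambda>i. g (J, i)"] by (simp add: top_energy_def)
    then show "(g (J, i))\<^sup>2 \<le> real (n J) * top_energy g" using assms(2) by simp
  qed
  also have "\<dots> = (real (n J))\<^sup>2 * top_energy g" by (simp add: power2_eq_square)
  finally show ?thesis by (simp add: n_J_square)
qed

lemma sum_W: "(\<Sum>v\<in>W. h v) = (\<Sum>j\<le>J. \<Sum>i<n j. h (j, i))"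
proof -
  have "W = Sigma {..J} (\<lambda>j. {..<n j})" by (auto simp: W_def)
  then show ?thesis by (simp add: sum.Sigma case_prod_beta)
qed

lemma finite_NT: "finite (NT v)"
  by (rule finite_subset[of _ W]) (use T_sub_W finite_W in \<open>auto simp: NT_def\<close>)

definition local_energy :: "(nat \<times> nat \<Rightarrow> real) \<Rightarrow> nat \<times> nat \<Rightarrow> real" where
  "local_energy g v = (\<Sum>w\<in>NT v. (g v - g w)\<^sup>2)"

lemma local_energy_ge:
  assumes "S \<subseteq> NT v"
  shows "(\<Sum>w\<in>S. (g v - g w)\<^sup>2) \<le> local_energy g v"
  unfolding local_energy_def by (intro sum_mono2 finite_NT assms) auto

lemma up_energy_le:
  assumes "j < J" "i < n j"
  shows "up_energy g j i \<le> local_energy g (j, i)"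
proof (cases "dbl j")
  case True
  then have "{(Suc j, 2 * i), (Suc j, Suc (2 * i))} \<subseteq> NT (j, i)"
    using T_vertical_double assms by (auto simp: NT_def)
  from local_energy_ge[OF this, of g] True show ?thesis by (simp add: up_energy_def)
next
  case False
  then have "{(Suc j, i)} \<subseteq> NT (j, i)" using T_vertical_straight assms by (auto simp: NT_def)
  from local_energy_ge[OF this, of g] False show ?thesis by (simp add: up_energy_def)
qed

lemma top_energy_le: "top_energy g \<le> (\<Sum>i<n J. local_energy g (J, i))"
proof -
  have "top_energy g \<le> (\<Sum>i<n J - 1. local_energy g (J, i))"
    unfolding top_energy_def
  proof (intro sum_mono)
    fix i assume "i \<in> {..<n J - 1}"
    then have "{(J, Suc i)} \<subseteq> NT (J, i)" using horizontal_in_T[of J i] by (auto simp: NT_def)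
    from local_energy_ge[OF this, of g]
    show "(g (J, Suc i) - g (J, i))\<^sup>2 \<le> local_energy g (J, i)" by (simp add: power2_commute)
  qed
  also have "\<dots> \<le> (\<Sum>i<n J. local_energy g (J, i))"
    by (intro sum_mono2) (auto simp: local_energy_def sum_nonneg)
  finally show ?thesis .
qed

text \<open>The mass at the top is multiplied by at most \<open>10 * L\<close>, hence contributes 40
  L^2, below 110 L^2. Upward edges are charged to their lower end and edges of the top row to their
  left end, so the energy at each vertex is used once.\<close>

lemma poincare_T:
  assumes "i0 < n J"
  shows "(\<Sum>v\<in>W. (g v - g (J, i0))\<^sup>2) \<le> 110 * (real L)\<^sup>2 * (\<Sum>v\<in>W. \<Sum>w\<in>NT v. (g v - g w)\<^sup>2)"
proof -
  define h where "h v = g v - g (J, i0)" for v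
  have le: "real (8 * L + 2 * (J mod L)) \<le> 10 * real L" using L_ge4 mod_less_divisor[of L J] by simp
  have "(\<Sum>v\<in>W. (h v)\<^sup>2) = (\<Sum>j\<le>J. mass h j)" by (simp add: sum_W mass_def)
  also have "\<dots> \<le> real (8 * L + 2 * (J mod L)) * mass h J + 110 * (real L)\<^sup>2 * (\<Sum>j<J. slab_energy h j)"
    by (rule mass_sum_le)
  also have "\<dots> \<le> 10 * real L * (4 * real L * top_energy h) + 110 * (real L)\<^sup>2 * (\<Sum>j<J. slab_energy h j)"
    using le assms by (intro add_right_mono mult_mono top_mass_le[of i0] mass_nonneg) (auto simp: h_def)
  also have "10 * real L * (4 * real L * top_energy h) \<le> 110 * (real L)\<^sup>2 * top_energy h"
    using mult_nonneg_nonneg[OF zero_le_power2[of "real L"] top_energy_nonneg[of h]] by (simp add: power2_eq_square)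
  also have "110 * (real L)\<^sup>2 * top_energy h + 110 * (real L)\<^sup>2 * (\<Sum>j<J. slab_energy h j)
      = 110 * (real L)\<^sup>2 * ((\<Sum>j<J. slab_energy h j) + top_energy h)" by (simp add: distrib_left)
  also have "\<dots> \<le> 110 * (real L)\<^sup>2 * ((\<Sum>j<J. \<Sum>i<n j. local_energy h (j, i)) + (\<Sum>i<n J. local_energy h (J, i)))"
    unfolding slab_energy_def by (intro mult_left_mono add_mono sum_mono up_energy_le top_energy_le) auto
  also have "\<dots> = 110 * (real L)\<^sup>2 * (\<Sum>v\<in>W. local_energy h v)"
    unfolding sum_W by (simp add: lessThan_Suc_atMost[symmetric])
  finally show ?thesis by (simp add: h_def local_energy_def)
qed

end

section \<open>The walk on the double\<close>

text \<open>The diameter is only bounded below, by \<open>J\<close>; monotonicity transfers the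
  bound from \<open>J\<close> to it.\<close>

lemma square_div_ln_mono:
  assumes "3 \<le> x" "x \<le> (y::real)"
  shows "x\<^sup>2 / ln x \<le> y\<^sup>2 / ln y"
proof -
  have "exp 1 < (3::real)" using e_less_272 by simp
  then have lx: "1 \<le> ln x" using assms by (subst ln_ge_iff) auto
  define r where "r = y / x"
  have r: "1 \<le> r" "y = r * x" using assms by (auto simp: r_def field_simps)
  have "ln r \<le> r - 1" using r by (intro ln_le_minus_one) auto
  also have "\<dots> \<le> r\<^sup>2 - 1" using r mult_left_mono[of 1 r r] by (simp add: power2_eq_square)
  also have "\<dots> \<le> (r\<^sup>2 - 1) * ln x" using lx r mult_left_mono[of 1 "ln x" "r\<^sup>2 - 1"] by simp
  finally have "ln y \<le> r\<^sup>2 * ln x" using r assms by (simp add: ln_mult algebra_simps)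
  then have "x\<^sup>2 * ln y \<le> y\<^sup>2 * ln x"
    using r mult_left_mono[of "ln y" "r\<^sup>2 * ln x" "x\<^sup>2"] by (simp add: power_mult_distrib mult_ac)
  moreover have "ln y > 0" using lx assms by simp
  ultimately show ?thesis using lx by (simp add: field_simps)
qed

text \<open>Applied to vertex counts, this yields pairwise non-isomorphic graphs without computing
  the counts.\<close>

lemma strictly_increasing_subsequence:
  fixes g :: "nat \<Rightarrow> nat"
  assumes "\<And>k. k \<le> g k"
  shows "\<exists>s :: nat \<Rightarrow> nat. strict_mono (g \<circ> s)"
proof
  show "strict_mono (g \<circ> (rec_nat 0 (\<lambda>_ k. Suc (g k))))"
    unfolding strict_mono_Suc_iff using assms by (auto simp: Suc_le_lessD)
qed

section \<open>Neighbourhoods and the Poincare inequality in the double\<close>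

context strip begin

definition V :: "nat set" where "V = \<Union>K"
definition NK :: "nat \<Rightarrow> nat set" where "NK x = {y. x \<noteq> y \<and> {x, y} \<in> K}"
definition chart :: "(nat \<times> nat \<Rightarrow> nat) \<Rightarrow> bool" where "chart \<phi> \<longleftrightarrow> \<phi> = front \<or> \<phi> = rear"

lemma chart_inj: "chart \<phi> \<Longrightarrow> inj_on \<phi> W"
  using inj_rear inj_on_subset[OF inj_front] by (auto simp: chart_def)

lemma chart_K: "chart \<phi> \<Longrightarrow> \<sigma> \<in> T \<Longrightarrow> \<phi> ` \<sigma> \<in> K"
  by (auto simp: chart_def K_def)

lemma K_chart: 
  assumes "\<sigma> \<in> K" obtains \<phi> \<tau> where "chart \<phi>" "\<tau> \<in> T" "\<sigma> = \<phi> ` \<tau>"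
  using assms by (auto simp: chart_def K_def)

lemma V_eq: "V = front ` W \<union> rear ` W"
  unfolding V_def K_def Union_T[symmetric] by blast

lemma V_chart:
  assumes "x \<in> V" obtains \<phi> v where "chart \<phi>" "v \<in> W" "x = \<phi> v"
  using assms unfolding V_eq chart_def by blast

lemma finite_V: "finite V" by (simp add: V_eq finite_W)

lemma chart_V: "chart \<phi> \<Longrightarrow> v \<in> W \<Longrightarrow> \<phi> v \<in> V"
  by (auto simp: V_eq chart_def)

lemma NT_W: "w \<in> NT v \<Longrightarrow> v \<in> W \<and> w \<in> W"
  using T_sub_W by (auto simp: NT_def)

lemma chart_NT: 
  assumes "chart \<phi>" "w \<in> NT v" shows "\<phi> w \<in> NK (\<phi> v)"
proof -
  have "\<phi> v \<noteq> \<phi> w"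
    using NT_W[OF assms(2)] inj_on_eq_iff[OF chart_inj[OF assms(1)], of v w] assms(2) by (auto simp: NT_def)
  then show ?thesis using chart_K[OF assms(1), of "{v, w}"] assms(2) by (simp add: NK_def NT_def)
qed

lemma NK_chart:
  assumes "y \<in> NK x"
  obtains \<phi> v w where "chart \<phi>" "w \<in> NT v" "x = \<phi> v" "y = \<phi> w"
proof -
  have "{x, y} \<in> K" using assms by (simp add: NK_def)
  then obtain \<phi> \<tau> where \<tau>: "chart \<phi>" "\<tau> \<in> T" "{x, y} = \<phi> ` \<tau>" by (rule K_chart)
  then have "x \<in> \<phi> ` \<tau>" "y \<in> \<phi> ` \<tau>" by blast+
  then obtain v w where vw: "v \<in> \<tau>" "w \<in> \<tau>" "x = \<phi> v" "y = \<phi> w" by blast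
  then have "w \<noteq> v" using assms by (auto simp: NK_def)
  moreover have "{v, w} \<in> T" using T_down[OF \<tau>(2)] vw by simp
  ultimately show ?thesis using that \<tau>(1) vw by (simp add: NT_def)
qed

lemma NK_sub: "NK x \<subseteq> V"
  by (auto elim!: NK_chart dest: NT_W chart_V)

lemma finite_NK: "finite (NK x)"
  by (rule finite_subset[OF NK_sub finite_V])

text \<open>The five boxes cover the own level, the level above and the level below, with plain and
  doubling slabs listed together so that no case distinction is left for the count.\<close>

lemma NT_sub:
  "NT (j, i) \<subseteq> {j} \<times> {i - 1..Suc i} \<union> {Suc j} \<times> {2 * i - 1..Suc (2 * i)} \<union> {Suc j} \<times> {i..Suc i}
     \<union> {j - 1} \<times> {i - 1..i} \<union> {j - 1} \<times> {i div 2..Suc (i div 2)}" (is "_ \<subseteq> ?R")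
proof
  fix w assume w: "w \<in> NT (j, i)"
  obtain j' i' where w': "w = (j', i')" by (cases w)
  have T: "{(j, i), (j', i')} \<in> T" using w w' by (simp add: NT_def)
  have "j' \<le> Suc j" "j \<le> Suc j'" using T_edge_level[OF T] by auto
  then consider "j' = j" | "j' = Suc j" | "j = Suc j'" by linarith
  then show "w \<in> ?R"
  proof cases
    case 1
    then have "i' \<le> Suc i" "i \<le> Suc i'" using T_edge_same[OF T, of j] by auto
    then show ?thesis using 1 w' by auto
  next
    case 2
    then have "if dbl j then 2 * i \<le> Suc i' \<and> i' \<le> Suc (2 * i) else i \<le> i' \<and> i' \<le> Suc i"
      using T_edge_vertical[OF T, of j i i'] by simp
    then show ?thesis using 2 w' by (auto split: if_splits)
  next
    case 3
    then have "if dbl j' then 2 * i' \<le> Suc i \<and> i \<le> Suc (2 * i') else i' \<le> i \<and> i \<le> Suc i'"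
      using T_edge_vertical[OF T, of j' i' i] by simp
    then show ?thesis using 3 w' by (auto split: if_splits)
  qed
qed

lemma card_NT_le: "card (NT v) \<le> 12"
proof -
  obtain j i where v: "v = (j, i)" by (cases v)
  let ?A = "{j} \<times> {i - 1..Suc i}" and ?B = "{Suc j} \<times> {2 * i - 1..Suc (2 * i)}" and ?C = "{Suc j} \<times> {i..Suc i}"
    and ?D = "{j - 1} \<times> {i - 1..i}" and ?E = "{j - 1} \<times> {i div 2..Suc (i div 2)}"
  have "card (NT v) \<le> card (?A \<union> ?B \<union> ?C \<union> ?D \<union> ?E)"
    unfolding v by (intro card_mono NT_sub) simp
  also have "\<dots> \<le> card ?A + card ?B + card ?C + card ?D + card ?E"
    by (intro order_trans[OF card_Un_le] add_mono order_refl)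
  also have "\<dots> \<le> 3 + 3 + 2 + 2 + 2"
    unfolding card_cartesian_product by (intro add_mono) auto
  finally show ?thesis by simp
qed

text \<open>A vertex may lie in both sheets, and each sheet contributes at most 12
  neighbours.\<close>

lemma card_NK_le: "card (NK x) \<le> 24"
proof -
  have sub: "card (NK x \<inter> {y. \<exists>v w. w \<in> NT v \<and> x = \<phi> v \<and> y = \<phi> w}) \<le> 12" if \<phi>: "chart \<phi>" for \<phi>
  proof (cases "\<exists>v\<in>W. x = \<phi> v")
    case True
    then obtain v where v: "v \<in> W" "x = \<phi> v" by blast
    have "v' = v" if "v' \<in> W" "x = \<phi> v'" for v'
      using that v inj_on_eq_iff[OF chart_inj[OF \<phi>], of v' v] by simp
    then have "NK x \<inter> {y. \<exists>v w. w \<in> NT v \<and> x = \<phi> v \<and> y = \<phi> w} \<subseteq> \<phi> ` NT v"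
      using NT_W by blast
    then have "card (NK x \<inter> {y. \<exists>v w. w \<in> NT v \<and> x = \<phi> v \<and> y = \<phi> w}) \<le> card (\<phi> ` NT v)"
      by (intro card_mono) (auto intro: finite_NT)
    also have "\<dots> \<le> card (NT v)" by (rule card_image_le[OF finite_NT])
    finally show ?thesis using card_NT_le[of v] by linarith
  next
    case False
    then have "NK x \<inter> {y. \<exists>v w. w \<in> NT v \<and> x = \<phi> v \<and> y = \<phi> w} = {}" using NT_W by blast
    then show ?thesis by simp
  qed
  have "NK x \<subseteq> (NK x \<inter> {y. \<exists>v w. w \<in> NT v \<and> x = front v \<and> y = front w})
      \<union> (NK x \<inter> {y. \<exists>v w. w \<in> NT v \<and> x = rear v \<and> y = rear w})" (is "_ \<subseteq> ?A \<union> ?B")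
  proof
    fix y assume y: "y \<in> NK x"
    then obtain \<phi> v w where vw: "chart \<phi>" "w \<in> NT v" "x = \<phi> v" "y = \<phi> w" by (rule NK_chart)
    then have "x = front v \<and> y = front w \<or> x = rear v \<and> y = rear w" by (auto simp: chart_def)
    then show "y \<in> ?A \<union> ?B" using y vw(2) by blast
  qed
  then have "card (NK x) \<le> card (?A \<union> ?B)" by (intro card_mono) (auto intro: finite_NK)
  also have "\<dots> \<le> card ?A + card ?B" by (rule card_Un_le)
  also have "\<dots> \<le> 12 + 12" by (intro add_mono sub) (auto simp: chart_def)
  finally show ?thesis by simp
qed

lemma NT_ne: "v \<in> W \<Longrightarrow> NT v \<noteq> {}"
proof -
  assume "v \<in> W"
  then obtain j i where v: "v = (j, i)" "j \<le> J" "i < n j" by (auto simp: W_def)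
  show ?thesis
  proof (cases "Suc i < n j")
    case True
    then have "(j, Suc i) \<in> NT v" using v horizontal_in_T[of j i] by (auto simp: NT_def)
    then show ?thesis by blast
  next
    case False
    then have i: "i > 0" "Suc (i - 1) = i" using v n_ge4[of j] by auto
    then have "(j, i - 1) \<in> NT v" using v horizontal_in_T[of j "i - 1"] by (auto simp: NT_def)
    then show ?thesis by blast
  qed
qed

lemma chart_energy:
  assumes \<phi>: "chart \<phi>"
  shows "(\<Sum>v\<in>W. \<Sum>w\<in>NT v. (f (\<phi> v) - f (\<phi> w))\<^sup>2) \<le> (\<Sum>x\<in>V. \<Sum>y\<in>NK x. (f x - f y :: real)\<^sup>2)"
proof -
  have "(\<Sum>v\<in>W. \<Sum>w\<in>NT v. (f (\<phi> v) - f (\<phi> w))\<^sup>2) \<le> (\<Sum>v\<in>W. \<Sum>y\<in>NK (\<phi> v). (f (\<phi> v) - f y)\<^sup>2)"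
  proof (intro sum_mono)
    fix v
    have "inj_on \<phi> (NT v)" using inj_on_subset[OF chart_inj[OF \<phi>]] NT_W by blast
    then have "(\<Sum>w\<in>NT v. (f (\<phi> v) - f (\<phi> w))\<^sup>2) = (\<Sum>y\<in>\<phi> ` NT v. (f (\<phi> v) - f y)\<^sup>2)"
      by (simp add: sum.reindex)
    also have "\<dots> \<le> (\<Sum>y\<in>NK (\<phi> v). (f (\<phi> v) - f y)\<^sup>2)"
      using chart_NT[OF \<phi>, of _ v] by (intro sum_mono2 finite_NK) auto
    finally show "(\<Sum>w\<in>NT v. (f (\<phi> v) - f (\<phi> w))\<^sup>2) \<le> (\<Sum>y\<in>NK (\<phi> v). (f (\<phi> v) - f y)\<^sup>2)" .
  qed
  also have "\<dots> = (\<Sum>x\<in>\<phi> ` W. \<Sum>y\<in>NK x. (f x - f y)\<^sup>2)"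
    using chart_inj[OF \<phi>] by (simp add: sum.reindex)
  also have "\<dots> \<le> (\<Sum>x\<in>V. \<Sum>y\<in>NK x. (f x - f y)\<^sup>2)"
    using chart_V[OF \<phi>] by (intro sum_mono2 finite_V) (auto intro: sum_nonneg)
  finally show ?thesis .
qed

text \<open>The corner \<open>front (J, 0) = rear (J, n J - 1)\<close> lies in both sheets, so one
  constant serves both. The factor is 5280 = 24 * 2 * 110: degree, two sheets, and the constant of
  one sheet.\<close>

lemma poincare_K:
  "\<exists>c. (\<Sum>x\<in>V. real (card (NK x)) * (f x - c)\<^sup>2) \<le> 5280 * (real L)\<^sup>2 * (\<Sum>x\<in>V. \<Sum>y\<in>NK x. (f x - f y)\<^sup>2)"
proof
  define c where "c = f (front (J, 0))"
  let ?E = "\<Sum>x\<in>V. \<Sum>y\<in>NK x. (f x - f y)\<^sup>2"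
  have "rear (J, n J - 1) = front (J, 0)" by (simp add: rear_def bd_def mir_def)
  then have c: "c = f (front (J, 0))" "c = f (rear (J, n J - 1))" by (simp_all add: c_def)
  have main: "(\<Sum>x\<in>\<phi> ` W. (f x - c)\<^sup>2) \<le> 110 * (real L)\<^sup>2 * ?E"
    if \<phi>: "chart \<phi>" and i: "i < n J" "c = f (\<phi> (J, i))" for \<phi> i
  proof -
    have "(\<Sum>x\<in>\<phi> ` W. (f x - c)\<^sup>2) = (\<Sum>v\<in>W. (f (\<phi> v) - f (\<phi> (J, i)))\<^sup>2)"
      using chart_inj[OF \<phi>] i by (simp add: sum.reindex)
    also have "\<dots> \<le> 110 * (real L)\<^sup>2 * (\<Sum>v\<in>W. \<Sum>w\<in>NT v. (f (\<phi> v) - f (\<phi> w))\<^sup>2)"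
      by (rule poincare_T[OF i(1)])
    also have "\<dots> \<le> 110 * (real L)\<^sup>2 * ?E" by (intro mult_left_mono chart_energy[OF \<phi>]) simp
    finally show ?thesis .
  qed
  have "(\<Sum>x\<in>V. real (card (NK x)) * (f x - c)\<^sup>2) \<le> (\<Sum>x\<in>V. 24 * (f x - c)\<^sup>2)"
    using card_NK_le by (intro sum_mono mult_right_mono) (auto simp: numeral_le_real_of_nat_iff)
  also have "\<dots> = 24 * (\<Sum>x\<in>V. (f x - c)\<^sup>2)" by (simp add: sum_distrib_left)
  also have "(\<Sum>x\<in>V. (f x - c)\<^sup>2) \<le> (\<Sum>x\<in>front ` W. (f x - c)\<^sup>2) + (\<Sum>x\<in>rear ` W. (f x - c)\<^sup>2)"
    unfolding V_eq using finite_W sum_nonneg[of "front ` W \<inter> rear ` W" "\<lambda>x. (f x - c)\<^sup>2"]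
    by (simp add: sum_Un)
  also have "\<dots> \<le> 110 * (real L)\<^sup>2 * ?E + 110 * (real L)\<^sup>2 * ?E"
    using n_ge4[of J] c by (intro add_mono main[of _ 0] main[of _ "n J - 1"]) (auto simp: chart_def)
  finally show "(\<Sum>x\<in>V. real (card (NK x)) * (f x - c)\<^sup>2) \<le> 5280 * (real L)\<^sup>2 * ?E" by simp
qed

lemma NK_sym: "y \<in> NK x \<Longrightarrow> x \<in> NK y"
  by (auto simp: NK_def insert_commute)

lemma NK_ne: "x \<in> V \<Longrightarrow> NK x \<noteq> {}"
proof -
  assume "x \<in> V"
  then obtain \<phi> v where v: "chart \<phi>" "v \<in> W" "x = \<phi> v" by (rule V_chart)
  then obtain w where "w \<in> NT v" using NT_ne by blast
  then show ?thesis using chart_NT v by blast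
qed

lemma NK_triangle:
  assumes "y \<in> NK x" shows "NK x \<inter> NK y \<noteq> {}"
proof -
  obtain \<phi> v w where vw: "chart \<phi>" "w \<in> NT v" "x = \<phi> v" "y = \<phi> w" using assms by (rule NK_chart)
  then have "{v, w} \<in> T" "v \<noteq> w" by (auto simp: NT_def)
  then obtain z where z: "z \<noteq> v" "z \<noteq> w" "{v, w, z} \<in> T" using T_edge_in_triangle by blast
  have "{v, z} \<in> T" "{w, z} \<in> T" by (rule T_down[OF z(3)]; blast)+
  then have "z \<in> NT v" "z \<in> NT w" using z by (auto simp: NT_def)
  then show ?thesis using chart_NT vw by blast
qed

abbreviation G :: "(nat, nat \<times> nat) pre_digraph" where "G \<equiv> one_skeleton K"

lemma out_arcs_G: "out_arcs G x = Pair x ` NK x"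
  by (auto simp: out_arcs_def one_skeleton_def NK_def)

lemma srw_step_G:
  assumes "x \<in> V"
  shows "srw_step G x = pmf_of_set (NK x)"
proof -
  have "srw_step G x = pmf_of_set (snd ` Pair x ` NK x)"
    unfolding srw_step_def out_arcs_G using NK_ne[OF assms] finite_NK
    by (subst map_pmf_of_set_inj) (auto simp: inj_on_def one_skeleton_def)
  then show ?thesis by (simp add: image_image)
qed

end

sublocale strip \<subseteq> triangular_graph V NK 24 "5280 * (real L)\<^sup>2" G
proof
  have "(0, 0) \<in> W" using n_ge4[of 0] by (simp add: W_def)
  then show "V \<noteq> {}" by (auto simp: V_eq)
  have "1 * 1 \<le> real L * real L" using L_ge4 by (intro mult_mono) auto
  then show "24 \<le> 5280 * (real L)\<^sup>2" by (simp add: power2_eq_square)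
  show "verts G = V" by (simp add: one_skeleton_def V_def)
  show "pmf (srw_step G x) y = (if y \<in> NK x then 1 / real (card (NK x)) else 0)" if "x \<in> V" for x y
    using NK_ne[OF that] finite_NK by (simp add: srw_step_G[OF that] indicator_def)
  show "real (card (NK x)) \<le> 24" for x using card_NK_le[of x] by linarith
qed (use finite_V NK_sub NK_sym NK_ne NK_triangle poincare_K in auto)

section \<open>Degree, diameter, number of vertices and mixing time\<close>

context strip begin

lemma degree_le: "graph_degree G \<le> 24"
proof -
  have "out_degree G x \<le> 24" for x
    unfolding out_degree_def out_arcs_G using card_NK_le[of x] by (simp add: card_image inj_on_def)
  then show ?thesis unfolding graph_degree_def verts_G using finV V_ne by (subst Max_le_iff) auto
qed

definition lev :: "nat \<Rightarrow> nat" where "lev x = fst (prod_decode (x div 2))"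

lemma lev_chart: "chart \<phi> \<Longrightarrow> lev (\<phi> v) = fst v"
  by (auto simp: chart_def lev_def front_def rear_def mir_def)

lemma lev_NK: "y \<in> NK x \<Longrightarrow> lev y \<le> Suc (lev x)"
proof -
  assume "y \<in> NK x"
  then obtain \<phi> v w where vw: "chart \<phi>" "w \<in> NT v" "x = \<phi> v" "y = \<phi> w" by (rule NK_chart)
  then have "{(fst v, snd v), (fst w, snd w)} \<in> T" by (simp add: NT_def)
  from T_edge_level[OF this, of "fst v" "snd v" "fst w" "snd w"] show ?thesis using vw by (simp add: lev_chart)
qed

lemma wf_G: "wf_digraph G"
  by unfold_locales (auto simp: one_skeleton_def)

interpretation WG: wf_digraph G by (rule wf_G)

lemma arc_G: "a \<in> arcs G \<longleftrightarrow> snd a \<in> NK (fst a)"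
  by (auto simp: one_skeleton_def NK_def)

lemma tail_head_G: "tail G a = fst a" "head G a = snd a"
  by (simp_all add: one_skeleton_def)

lemma awalk_lev: "WG.awalk x p y \<Longrightarrow> lev y \<le> lev x + length p"
proof (induction p arbitrary: x)
  case Nil
  then show ?case by (simp add: WG.awalk_Nil_iff)
next
  case (Cons a p)
  then have "snd a \<in> NK (fst a)" "x = fst a" "WG.awalk (snd a) p y"
    by (auto simp: WG.awalk_Cons_iff arc_G tail_head_G)
  then show ?case using Cons.IH[of "snd a"] lev_NK[of "snd a" x] by simp
qed

lemma awalk_cost_one: "WG.awalk_cost (\<lambda>_. 1) p = real (length p)"
  by (induction p) auto

lemma awalk_exists:
  assumes x: "x \<in> V" and y: "y \<in> V"
  shows "\<exists>p. WG.awalk x p y"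
proof -
  let ?S = "{y. \<exists>p. WG.awalk x p y}"
  have "?S = V"
  proof (rule connected)
    show "?S \<subseteq> V" using WG.awalk_last_in_verts verts_G by auto
    have "WG.awalk x [] x" using x verts_G by (simp add: WG.awalk_Nil_iff)
    then show "?S \<noteq> {}" by blast
    fix y z assume "y \<in> ?S" and z: "z \<in> NK y"
    then obtain p where p: "WG.awalk x p y" by blast
    have "WG.awalk y [(y, z)] z"
      using z NK_sub[of y] NK_sub[of z] NK_sym[OF z] verts_G
      by (auto simp: WG.awalk_Cons_iff WG.awalk_Nil_iff arc_G tail_head_G)
    then show "z \<in> ?S" using WG.awalk_appendI[OF p] by blast
  qed
  then show ?thesis using y by blast
qed

text \<open>Levels change by at most 1 along an edge. Finiteness must be shown too, as
  \<open>real_of_ereal\<close> sends infinity to 0.\<close>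

lemma diam_ge: "real J \<le> graph_diam G"
proof -
  let ?S = "SUP u\<in>V. SUP v\<in>V. WG.\<mu> (\<lambda>_. 1) u v"
  let ?a = "front (0, 0)" and ?b = "front (J, 0)"
  have ab: "?a \<in> V" "?b \<in> V" using n_ge4[of 0] n_ge4[of J] by (auto simp: V_eq W_def)
  have lev: "lev ?a = 0" "lev ?b = J" using lev_chart[of front] by (auto simp: chart_def)
  have "ereal (real J) \<le> WG.\<mu> (\<lambda>_. 1) ?a ?b"
    unfolding WG.\<mu>_def
  proof (rule INF_greatest)
    fix p assume "p \<in> {p. WG.awalk ?a p ?b}"
    then have "J \<le> length p" using awalk_lev[of ?a p ?b] lev by simp
    then show "ereal (real J) \<le> ereal (WG.awalk_cost (\<lambda>_. 1) p)" by (simp add: awalk_cost_one)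
  qed
  also have "\<dots> \<le> ?S" using ab by (intro SUP_upper2[of ?a] SUP_upper2[of ?b]) auto
  finally have low: "ereal (real J) \<le> ?S" .
  have "\<forall>u\<in>V. \<forall>v\<in>V. \<exists>p. WG.awalk u p v" using awalk_exists by blast
  then obtain w where w: "\<And>u v. u \<in> V \<Longrightarrow> v \<in> V \<Longrightarrow> WG.awalk u (w u v) v" by metis
  \<comment> \<open>Any finite bound will do, such as the total length of one chosen walk for every
    pair.\<close>
  define B where "B = (\<Sum>u\<in>V. \<Sum>v\<in>V. length (w u v))"
  have "?S \<le> ereal (real B)"
  proof (intro SUP_least)
    fix u v assume uv: "u \<in> V" "v \<in> V"
    have "WG.\<mu> (\<lambda>_. 1) u v \<le> ereal (WG.awalk_cost (\<lambda>_. 1) (w u v))"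
      by (rule WG.min_cost_le_walk_cost[OF w[OF uv]])
    also have "\<dots> = ereal (real (length (w u v)))" by (simp add: awalk_cost_one)
    also have "length (w u v) \<le> (\<Sum>v\<in>V. length (w u v))" using uv finV by (intro member_le_sum) auto
    also have "\<dots> \<le> B" unfolding B_def using uv finV by (intro member_le_sum[of u]) auto
    finally show "WG.\<mu> (\<lambda>_. 1) u v \<le> ereal (real B)" by simp
  qed
  then have "?S \<noteq> \<infinity>" by auto
  then have "real_of_ereal (ereal (real J)) \<le> real_of_ereal ?S"
    using low by (intro real_of_ereal_positive_mono) auto
  then show ?thesis by (simp add: graph_diam_def verts_G)
qed

lemma card_V_ge: "m \<le> card V"
proof -
  have "(j, 0) \<in> W" if "j \<le> J" for j using that n_ge4[of j] by (simp add: W_def)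
  then have "(\<lambda>j. front (j, 0)) ` {..J} \<subseteq> V" by (auto simp: V_eq)
  then have "card ((\<lambda>j. front (j, 0)) ` {..J}) \<le> card V" using finV by (intro card_mono)
  moreover have "inj_on (\<lambda>j. front (j, 0)) {..J}" by (rule inj_onI) (simp add: inj_eq[OF inj_front])
  ultimately have "Suc J \<le> card V" by (simp add: card_image)
  moreover have "m * 1 \<le> m * L" using L_ge4 by (intro mult_left_mono) auto
  ultimately show ?thesis using Suc_J by linarith
qed

lemma card_V_le: "card V \<le> 4 * m * 8 ^ m"
proof -
  have "card V \<le> card (front ` W) + card (rear ` W)" unfolding V_eq by (rule card_Un_le)
  also have "\<dots> \<le> card W + card W" by (intro add_mono card_image_le finite_W)
  also have "card W = (\<Sum>j\<le>J. n j)"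
  proof -
    have "W = Sigma {..J} (\<lambda>j. {..<n j})" by (auto simp: W_def)
    then show ?thesis by simp
  qed
  also have "\<dots> \<le> (\<Sum>j\<le>J. n J)"
    unfolding n_def by (intro sum_mono mult_left_mono power_increasing div_le_mono) auto
  also have "\<dots> = m * L * n J" using Suc_J by simp
  also have "\<dots> = 2 * m * 8 ^ m"
    unfolding n_J L_def by (simp add: power_mult_distrib[symmetric])
  finally show ?thesis by simp
qed

text \<open>The volume is at most 24 * 4 m 8^m, and 16 * 96 = 1536 is below 2^11. The logarithm is
  thus at most 11 + 4 m \<le> 15 m, and 79200 = 5280 * 15.\<close>

lemma mixing_le: "mixing_time G \<le> enat (79200 * m * L\<^sup>2)"
proof (rule mixing_time_le)
  let ?B = "96 * real m * 8 ^ m"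
  have "real (card V) \<le> real (4 * m * 8 ^ m)" by (intro of_nat_mono card_V_le)
  then show "real (card V) * 24 \<le> ?B" by simp
  have m1: "1 \<le> real m" using m_pos by simp
  have "real m \<le> 2 ^ m" using of_nat_mono[OF less_imp_le[OF less_exp[of m]], where 'a = real] by simp
  then have "1536 * real m * 8 ^ m \<le> 2 ^ 11 * 2 ^ m * 8 ^ m" by (intro mult_mono) auto
  then have "16 * ?B \<le> 2 ^ 11 * 2 ^ m * 8 ^ m" by simp
  also have "\<dots> = 2 ^ (11 + m + 3 * m)" by (simp add: power_add power_mult power_mult_distrib[symmetric])
  finally have le: "16 * ?B \<le> 2 ^ (11 + m + 3 * m)" .
  have "ln (16 * ?B) \<le> ln (2 ^ (11 + m + 3 * m))" using le m1 by (subst ln_le_cancel_iff) auto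
  also have "\<dots> = real (11 + m + 3 * m) * ln 2" by (rule ln_realpow)
  also have "\<dots> \<le> real (11 + m + 3 * m) * 1" using ln_2_less_1 by (intro mult_left_mono) auto
  also have "\<dots> \<le> 15 * real m" using m1 by simp
  finally have "5280 * (real L)\<^sup>2 * ln (16 * ?B) \<le> 5280 * (real L)\<^sup>2 * (15 * real m)"
    by (intro mult_left_mono) auto
  then show "5280 * (real L)\<^sup>2 * ln (16 * ?B) \<le> real (79200 * m * L\<^sup>2)" by (simp add: mult_ac)
qed

text \<open>From \<open>J \<le> 2 ^ m * 4 ^ m\<close> follows \<open>ln J \<le> 3 * m\<close>, and
  from \<open>m * L = J + 1 \<le> 2 * J\<close> follows m^2 L^2 \<le> 4 J^2. Together m L^2 is at
  most 12 J^2 / ln J, and 950400 = 79200 * 12.\<close>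

lemma mixing_bound:
  "ereal_of_enat (mixing_time G) \<le> ereal (950400 * (graph_diam G)\<^sup>2 / ln (graph_diam G))"
proof -
  have J3: "3 \<le> real J" using J_ge3 by simp
  have mL: "real m * real L = real J + 1" using Suc_J by (metis of_nat_Suc of_nat_mult add.commute)
  have "exp 1 < (3::real)" using e_less_272 by simp
  then have lJ: "1 \<le> ln (real J)" using J3 by (subst ln_ge_iff) auto
  have m2: "real m \<le> 2 ^ m" using of_nat_mono[OF less_imp_le[OF less_exp[of m]], where 'a = real] by simp
  have "real J \<le> real m * real L" using mL by simp
  also have "\<dots> \<le> 2 ^ m * 4 ^ m" using m2 by (simp add: L_def)
  also have "\<dots> = 2 ^ (3 * m)" by (simp add: power_mult power_mult_distrib[symmetric])
  finally have "ln (real J) \<le> ln (2 ^ (3 * m))" using J3 by (subst ln_le_cancel_iff) auto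
  also have "\<dots> = real (3 * m) * ln 2" by (rule ln_realpow)
  also have "\<dots> \<le> real (3 * m) * 1" using ln_2_less_1 by (intro mult_left_mono) auto
  finally have lm: "ln (real J) \<le> 3 * real m" by simp
  have "real m * real L \<le> 2 * real J" using mL J3 by simp
  then have "(real m * real L)\<^sup>2 \<le> (2 * real J)\<^sup>2" by (intro power_mono) auto
  then have sq: "real m * (real m * (real L)\<^sup>2) \<le> 4 * (real J)\<^sup>2" by (simp add: power2_eq_square mult_ac)
  have "real m * (real L)\<^sup>2 * ln (real J) \<le> real m * (real L)\<^sup>2 * (3 * real m)"
    by (intro mult_left_mono lm) auto
  also have "\<dots> \<le> 12 * (real J)\<^sup>2" using sq by (simp add: mult_ac)
  finally have "real m * (real L)\<^sup>2 \<le> 12 * ((real J)\<^sup>2 / ln (real J))" using lJ by (simp add: field_simps)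
  also have "(real J)\<^sup>2 / ln (real J) \<le> (graph_diam G)\<^sup>2 / ln (graph_diam G)"
    by (rule square_div_ln_mono[OF J3 diam_ge])
  finally have "real (79200 * m * L\<^sup>2) \<le> 950400 * (graph_diam G)\<^sup>2 / ln (graph_diam G)" by simp
  moreover have "ereal_of_enat (mixing_time G) \<le> ereal_of_enat (enat (79200 * m * L\<^sup>2))"
    using mixing_le by (simp only: ereal_of_enat_le_iff)
  ultimately show ?thesis by (simp del: of_nat_mult add: order_trans)
qed

end

theorem corollary1p4:
  shows "\<exists>(d::real) (C::real) (X :: nat \<Rightarrow> nat set set).
    d > 0 \<and> C > 0 \<and>
    (\<forall>n. sphere_triangulation (X n)) \<and>
    (\<forall>m n. m \<noteq> n \<longrightarrow> \<not> digraph_iso (one_skeleton (X m)) (one_skeleton (X n))) \<and>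
    (\<forall>n. real (graph_degree (one_skeleton (X n))) \<le> d) \<and>
    (\<forall>n. graph_diam (one_skeleton (X n)) \<ge> 2) \<and>
    (\<forall>n. ereal_of_enat (mixing_time (one_skeleton (X n)))
          \<le> ereal (C * (graph_diam (one_skeleton (X n)))\<^sup>2 / ln (graph_diam (one_skeleton (X n)))))"
proof -
  have strip: "strip (Suc k)" for k by unfold_locales simp
  let ?c = "\<lambda>k. card (\<Union>(strip.K (Suc k)))"
  have "k \<le> ?c k" for k
    using strip.card_V_ge[OF strip[of k]] by (simp add: strip.V_def[OF strip])
  then have "\<exists>s :: nat \<Rightarrow> nat. strict_mono (?c \<circ> s)" by (rule strictly_increasing_subsequence)
  then obtain s :: "nat \<Rightarrow> nat" where s: "strict_mono (?c \<circ> s)" by blast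
  define X where "X k = strip.K (Suc (s k))" for k
  have "\<not> digraph_iso (one_skeleton (X a)) (one_skeleton (X b))" if "a \<noteq> b" for a b
  proof
    assume "digraph_iso (one_skeleton (X a)) (one_skeleton (X b))"
    then obtain f where f: "pre_digraph.digraph_isomorphism (one_skeleton (X a)) f"
      "one_skeleton (X b) = app_iso f (one_skeleton (X a))" unfolding digraph_iso_def by blast
    \<comment> \<open>An isomorphism preserves the number of vertices, which strictly increases
      along the chosen subsequence.\<close>
    have "card (iso_verts f ` verts (one_skeleton (X a))) = card (verts (one_skeleton (X a)))"
      using f(1) by (intro card_image) (simp add: pre_digraph.digraph_isomorphism_def)
    then have "card (verts (one_skeleton (X b))) = card (verts (one_skeleton (X a)))" by (simp add: f(2))
    then have "(?c \<circ> s) b = (?c \<circ> s) a" by (simp add: X_def one_skeleton_def)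
    then show False using strict_mono_eq[OF s, of b a] that by blast
  qed
  moreover have "sphere_triangulation (X k)" "real (graph_degree (one_skeleton (X k))) \<le> 24"
    "graph_diam (one_skeleton (X k)) \<ge> 2"
    "ereal_of_enat (mixing_time (one_skeleton (X k)))
      \<le> ereal (950400 * (graph_diam (one_skeleton (X k)))\<^sup>2 / ln (graph_diam (one_skeleton (X k))))" for k
    using strip.K_sphere_triangulation[OF strip] strip.degree_le[OF strip, of "s k"]
      strip.diam_ge[OF strip, of "s k"] strip.J_ge3[OF strip, of "s k"] strip.mixing_bound[OF strip]
    by (auto simp: X_def)
  ultimately show ?thesis by (intro exI[of _ 24] exI[of _ 950400] exI[of _ X]) auto
qed

end
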